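(* There exist absolute constants $0<a<b<\infty$ such that the following holds. Let $\{\sigma_n\}_{n\in\mathbb{Z}}$ be complex numbers whose absolute values are non-increasing, in the sense that $|\sigma_{n+1}|\le|\sigma_n|$ for $n\ge 0$ and $|\sigma_{n-1}|\le|\sigma_n|$ for $n\le 0$. Let $\mathcal{X}\subset\mathbb{C}^{\mathbb{Z}}$ be the trigonometric space, consisting of all signals $x(t)$, $t\in\mathbb{T}=\mathbb{R}/\mathbb{Z}$, where $x_n(t)=e^{2\pi i n t}\sigma_n$ for $n\in\mathbb{Z}$. Let $$s:=\limsup_{k\to\infty}\frac{1}{\log k}\sum_{|n|<k}|\sigma_n|^2 .$$ If $s>b$ then $\mathcal{X}$ admits recovery, while if $s<a$ then $\mathcal{X}$ does not admit detection.
   Context: Noise: $\xi=(\xi_n)_{n\in\mathbb{Z}}$ is a sequence of independent standard complex Gaussian random variables, meaning that the real and imaginary parts of each $\xi_n$ are independent and each distributed as $N(0,1)$. A set $\mathcal{X}\subset\mathbb{C}^{\mathbb{Z}}$ admits recovery if there is a Borel measurable map $T:\mathbb{C}^{\mathbb{Z}}\to\mathbb{C}^{\mathbb{Z}}$ such that for each $x\in\mathcal{X}$, $T(x+\xi)=x$ almost surely. A set $\mathcal{X}\subset\mathbb{C}^{\mathbb{Z}}$ admits detection if there is a Borel measurable map $T:\mathbb{C}^{\mathbb{Z}}\to\{0,1\}$ such that $T(\xi)=0$ almost surely and, for every $x\in\mathcal{X}$, $T(x+\xi)=1$ almost surely. (Borel structure is that of the product topology.) *)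

theory Defs
  imports "HOL-Probability.Probability"
begin

text \<open>Real and imaginary part are each N(0,1), so \<open>E |Z|^2 = 2\<close> (not 1).\<close>

definition std_complex_noise :: "'w measure \<Rightarrow> (int \<Rightarrow> 'w \<Rightarrow> complex) \<Rightarrow> bool" where
  "std_complex_noise M \<xi> \<longleftrightarrow>
     prob_space M \<and>
     prob_space.indep_vars M (\<lambda>_. borel) \<xi> UNIV \<and>
     (\<forall>n. prob_space.indep_var M borel (\<lambda>\<omega>. Re (\<xi> n \<omega>)) borel (\<lambda>\<omega>. Im (\<xi> n \<omega>)) \<and>
          distributed M lborel (\<lambda>\<omega>. Re (\<xi> n \<omega>)) std_normal_density \<and>
          distributed M lborel (\<lambda>\<omega>. Im (\<xi> n \<omega>)) std_normal_density)"

definition std_complex_gaussian :: "complex measure" where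
  "std_complex_gaussian =
     distr (density lborel std_normal_density \<Otimes>\<^sub>M density lborel std_normal_density) borel
       (\<lambda>(u, v). Complex u v)"

text \<open>
  Recovery and detection only involve almost sure statements about \<open>x + \<xi>\<close>, so \<open>\<xi>\<close> enters only
  through its law on the sequence space. The lemmas \<open>noise_realises\<close> and \<open>noise_law_unique\<close>
  below identify this law with that of any noise sequence as in \<open>std_complex_noise\<close>.
\<close>

definition noise :: "(int \<Rightarrow> complex) measure" where
  "noise = (\<Pi>\<^sub>M n\<in>UNIV. std_complex_gaussian)"

text \<open>
  \<open>borel\<close> on \<^typ>\<open>int \<Rightarrow> complex\<close> refers to the library's topology on function types, which is the
  product topology.
\<close>

definition admits_recovery :: "(int \<Rightarrow> complex) set \<Rightarrow> bool" where
  "admits_recovery X \<longleftrightarrow>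
     (\<exists>T \<in> (borel :: (int \<Rightarrow> complex) measure) \<rightarrow>\<^sub>M (borel :: (int \<Rightarrow> complex) measure).
        \<forall>x\<in>X. AE \<xi> in noise. T (\<lambda>n. x n + \<xi> n) = x)"

definition admits_detection :: "(int \<Rightarrow> complex) set \<Rightarrow> bool" where
  "admits_detection X \<longleftrightarrow>
     (\<exists>T \<in> (borel :: (int \<Rightarrow> complex) measure) \<rightarrow>\<^sub>M count_space {0, 1 :: nat}.
        (AE \<xi> in noise. T \<xi> = 0) \<and>
        (\<forall>x\<in>X. AE \<xi> in noise. T (\<lambda>n. x n + \<xi> n) = 1))"

text \<open>
  The signal depends on \<open>t\<close> only modulo 1, so letting \<open>t\<close> range over the reals yields exactly the
  signals indexed by the circle \<open>R/Z\<close>.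
\<close>

definition trig_signal :: "(int \<Rightarrow> complex) \<Rightarrow> real \<Rightarrow> int \<Rightarrow> complex" where
  "trig_signal \<sigma> t n = exp (2 * of_real pi * \<i> * of_int n * of_real t) * \<sigma> n"

definition trig_space :: "(int \<Rightarrow> complex) \<Rightarrow> (int \<Rightarrow> complex) set" where
  "trig_space \<sigma> = range (trig_signal \<sigma>)"

lemma measurable_Complex [measurable]:
  "(\<lambda>(u, v). Complex u v) \<in> borel_measurable (borel \<Otimes>\<^sub>M borel)"
proof -
  have "(\<lambda>p::real \<times> real. Complex (fst p) (snd p))
      = (\<lambda>p. of_real (fst p) + \<i> * of_real (snd p))"
    by (auto simp: complex_eq_iff)
  moreover have "(\<lambda>p::real \<times> real. complex_of_real (fst p) + \<i> * of_real (snd p))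
      \<in> borel_measurable (borel \<Otimes>\<^sub>M borel)"
    by measurable
  ultimately show ?thesis by (simp add: case_prod_beta')
qed

lemma sets_std_complex_gaussian [simp, measurable_cong]:
  "sets std_complex_gaussian = sets borel"
  by (simp add: std_complex_gaussian_def)

lemma space_std_complex_gaussian [simp]: "space std_complex_gaussian = UNIV"
  by (simp add: std_complex_gaussian_def)

lemma prob_space_std_normal: "prob_space (density lborel (\<lambda>x. ennreal (std_normal_density x)))"
  by (rule prob_space_normal_density) simp

lemma prob_space_std_complex_gaussian: "prob_space std_complex_gaussian"
proof -
  interpret N: prob_space "density lborel (\<lambda>x. ennreal (std_normal_density x))"
    by (rule prob_space_std_normal)
  interpret P: pair_prob_space "density lborel (\<lambda>x. ennreal (std_normal_density x))"
    "density lborel (\<lambda>x. ennreal (std_normal_density x))" ..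
  have "(\<lambda>(u, v). Complex u v) \<in> borel_measurable
     (density lborel (\<lambda>x. ennreal (std_normal_density x)) \<Otimes>\<^sub>M
      density lborel (\<lambda>x. ennreal (std_normal_density x)))"
    by measurable
  then show ?thesis
    unfolding std_complex_gaussian_def by (rule P.prob_space_distr)
qed

lemma sets_noise [simp, measurable_cong]: "sets noise = sets borel"
proof -
  have "sets noise = sets (\<Pi>\<^sub>M n\<in>(UNIV::int set). (borel :: complex measure))"
    unfolding noise_def by (intro sets_PiM_cong) auto
  then show ?thesis by (simp only: sets_PiM_equal_borel)
qed

lemma space_noise [simp]: "space noise = UNIV"
  by (rule sets_eq_imp_space_eq[OF sets_noise, unfolded space_borel])

lemma prob_space_noise: "prob_space noise"
  unfolding noise_def by (intro prob_space_PiM prob_space_std_complex_gaussian)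

lemma noise_law_unique:
  assumes "std_complex_noise M \<xi>"
  shows "distr M borel (\<lambda>\<omega> n. \<xi> n \<omega>) = noise"
proof -
  interpret prob_space M using assms by (simp add: std_complex_noise_def)
  have ind: "indep_vars (\<lambda>_. borel) \<xi> UNIV"
    and n: "\<And>n. indep_var borel (\<lambda>\<omega>. Re (\<xi> n \<omega>)) borel (\<lambda>\<omega>. Im (\<xi> n \<omega>))"
    "\<And>n. distributed M lborel (\<lambda>\<omega>. Re (\<xi> n \<omega>)) std_normal_density"
    "\<And>n. distributed M lborel (\<lambda>\<omega>. Im (\<xi> n \<omega>)) std_normal_density"
    using assms by (auto simp: std_complex_noise_def)
  have rv [measurable]: "\<xi> n \<in> borel_measurable M" for n
    using ind by (auto simp: indep_vars_def)
  have law: "distr M borel (\<xi> n) = std_complex_gaussian" for n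
  proof -
    have d: "distr M borel (\<lambda>\<omega>. Re (\<xi> n \<omega>)) = density lborel std_normal_density"
      "distr M borel (\<lambda>\<omega>. Im (\<xi> n \<omega>)) = density lborel std_normal_density"
      using distributed_distr_eq_density[OF n(2)] distributed_distr_eq_density[OF n(3)]
      by (auto cong: distr_cong)
    have "std_complex_gaussian = distr (distr M (borel \<Otimes>\<^sub>M borel)
        (\<lambda>\<omega>. (Re (\<xi> n \<omega>), Im (\<xi> n \<omega>)))) borel (\<lambda>(u, v). Complex u v)"
      using n(1)[of n] unfolding indep_var_distribution_eq std_complex_gaussian_def d by simp
    also have "\<dots> = distr M borel (\<xi> n)"
      by (subst distr_distr) (auto simp: comp_def)
    finally show ?thesis by simp
  qed
  have "distr M (\<Pi>\<^sub>M n\<in>UNIV. borel) (\<lambda>\<omega>. \<lambda>n\<in>UNIV. \<xi> n \<omega>) = (\<Pi>\<^sub>M n\<in>UNIV. distr M borel (\<xi> n))"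
    using indep_vars_iff_distr_eq_PiM[of UNIV \<xi> "\<lambda>_. borel"] ind by simp
  moreover have "distr M (\<Pi>\<^sub>M n\<in>UNIV. borel) (\<lambda>\<omega>. \<lambda>n\<in>UNIV. \<xi> n \<omega>) = distr M borel (\<lambda>\<omega> n. \<xi> n \<omega>)"
    by (rule distr_cong) (auto simp: sets_PiM_equal_borel)
  ultimately show ?thesis by (simp add: law noise_def)
qed

lemma noise_realises: "std_complex_noise noise (\<lambda>n \<omega>. \<omega> n)"
proof -
  interpret prob_space noise by (rule prob_space_noise)
  let ?N = "density lborel (\<lambda>x. ennreal (std_normal_density x))"
  interpret N: prob_space ?N by (rule prob_space_std_normal)
  have [measurable]: "(\<lambda>\<omega>. \<omega> n) \<in> borel_measurable noise" for n
    by (simp add: measurable_cong_sets[OF sets_noise refl])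
  have comp: "distr noise borel (\<lambda>\<omega>. \<omega> n) = std_complex_gaussian" for n
  proof -
    have "distr noise std_complex_gaussian (\<lambda>\<omega>. \<omega> n) = std_complex_gaussian"
      unfolding noise_def
      by (rule distr_PiM_component) (auto intro: prob_space_std_complex_gaussian)
    moreover have "distr noise std_complex_gaussian (\<lambda>\<omega>. \<omega> n) = distr noise borel (\<lambda>\<omega>. \<omega> n)"
      by (rule distr_cong) auto
    ultimately show ?thesis by simp
  qed
  have C [measurable]: "(\<lambda>(u, v). Complex u v) \<in> borel_measurable (?N \<Otimes>\<^sub>M ?N)"
    by measurable
  have pair: "distr noise (borel \<Otimes>\<^sub>M borel) (\<lambda>\<omega>. (Re (\<omega> n), Im (\<omega> n))) = ?N \<Otimes>\<^sub>M ?N" for n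
  proof -
    have "distr noise (borel \<Otimes>\<^sub>M borel) (\<lambda>\<omega>. (Re (\<omega> n), Im (\<omega> n)))
        = distr (distr noise borel (\<lambda>\<omega>. \<omega> n)) (borel \<Otimes>\<^sub>M borel) (\<lambda>z. (Re z, Im z))"
      by (subst distr_distr) (auto simp: comp_def)
    also have "\<dots> = distr (?N \<Otimes>\<^sub>M ?N) (borel \<Otimes>\<^sub>M borel) (\<lambda>p. p)"
      unfolding comp std_complex_gaussian_def
      by (subst distr_distr) (auto simp: comp_def case_prod_beta')
    also have "\<dots> = ?N \<Otimes>\<^sub>M ?N"
      by (rule distr_id2) (auto intro!: sets_pair_measure_cong)
    finally show ?thesis .
  qed
  have re: "distr noise borel (\<lambda>\<omega>. Re (\<omega> n)) = ?N" for n
  proof -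
    have "distr noise borel (\<lambda>\<omega>. Re (\<omega> n)) = distr (?N \<Otimes>\<^sub>M ?N) borel fst"
      unfolding pair[of n, symmetric] by (subst distr_distr) (auto simp: comp_def)
    also have "\<dots> = distr (?N \<Otimes>\<^sub>M ?N) ?N fst" by (rule distr_cong) auto
    also have "\<dots> = ?N" by (simp add: N.distr_pair_fst N.emeasure_space_1)
    finally show ?thesis .
  qed
  have im: "distr noise borel (\<lambda>\<omega>. Im (\<omega> n)) = ?N" for n
  proof -
    interpret P: pair_sigma_finite ?N ?N ..
    have "distr noise borel (\<lambda>\<omega>. Im (\<omega> n)) = distr (?N \<Otimes>\<^sub>M ?N) borel snd"
      unfolding pair[of n, symmetric] by (subst distr_distr) (auto simp: comp_def)
    also have "\<dots> = distr (?N \<Otimes>\<^sub>M ?N) ?N snd" by (rule distr_cong) auto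
    also have "\<dots> = distr (distr (?N \<Otimes>\<^sub>M ?N) (?N \<Otimes>\<^sub>M ?N) (\<lambda>(x, y). (y, x))) ?N snd"
      by (simp only: P.distr_pair_swap[symmetric])
    also have "\<dots> = distr (?N \<Otimes>\<^sub>M ?N) ?N fst"
      by (subst distr_distr) (auto simp: comp_def case_prod_beta')
    also have "\<dots> = ?N" by (simp add: N.distr_pair_fst N.emeasure_space_1)
    finally show ?thesis .
  qed
  have "indep_vars (\<lambda>_. borel) (\<lambda>n \<omega>. \<omega> n) (UNIV :: int set)"
  proof -
    have "distr noise (\<Pi>\<^sub>M n\<in>UNIV. borel) (\<lambda>\<omega>. \<lambda>n\<in>UNIV. \<omega> n) = noise"
      using distr_id2[of "\<Pi>\<^sub>M n\<in>(UNIV::int set). (borel :: complex measure)" noise]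
      by (simp add: sets_PiM_equal_borel restrict_def)
    then show ?thesis
      by (subst indep_vars_iff_distr_eq_PiM) (auto simp: comp noise_def[symmetric])
  qed
  moreover have "indep_var borel (\<lambda>\<omega>. Re (\<omega> n)) borel (\<lambda>\<omega>. Im (\<omega> n))" for n :: int
    unfolding indep_var_distribution_eq by (simp add: re im pair)
  moreover have "distributed noise lborel (\<lambda>\<omega>. Re (\<omega> n)) std_normal_density" for n :: int
    using re[of n] by (auto simp: distributed_def cong: distr_cong)
  moreover have "distributed noise lborel (\<lambda>\<omega>. Im (\<omega> n)) std_normal_density" for n :: int
    using im[of n] by (auto simp: distributed_def cong: distr_cong)
  ultimately show ?thesis
    by (simp add: std_complex_noise_def prob_space_noise)
qed

end

theory Submission
  imports Defs "HOL-Real_Asymp.Real_Asymp"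
begin

text \<open>
  Write \<open>V\<^sub>k\<close> for the sum of \<open>|\<sigma>\<^sub>n|\<^sup>2\<close> over \<open>|n| < k\<close>. Restricted to this window, the inner product of the
  signals at times \<open>t\<close> and \<open>s\<close> is the sum of \<open>|\<sigma>\<^sub>n|\<^sup>2 cos (2 \<pi> n (t - s))\<close>. It equals \<open>V\<^sub>k\<close> at \<open>t = s\<close>, and
  since \<open>|\<sigma>\<^sub>n|\<close> decreases on both sides, Abel summation bounds it away from \<open>t = s\<close> independently of \<open>k\<close>.

  Recovery: along a sequence of \<open>k\<close> with \<open>V\<^sub>k > 96 log k\<close>, correlate the observation with the signals at
  \<open>16 k\<close> equispaced times and take a time whose score exceeds \<open>V\<^sub>k / 2\<close>. The noise contributes a
  Gaussian of variance \<open>V\<^sub>k\<close> to each score, so by a union bound all noise terms are below \<open>V\<^sub>k / 4\<close> outside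
  an event of probability \<open>O(1 / k\<^sup>2)\<close>. By Borel-Cantelli the chosen times converge to the true one on the
  circle.

  Non-detection: average the law of signal plus noise over \<open>t\<close>. On a window, the second moment of
  its likelihood ratio against the noise is the average of \<open>exp\<close> of the inner product above. Splitting
  the sum at \<open>n = 1 / |u|\<close>, where \<open>u = t - s\<close>, and using \<open>V\<^sub>k \<le> log k / 4\<close> for large \<open>k\<close>, this is at most a constant times
  \<open>|u|\<close> to the power \<open>-1/2\<close>, which is integrable. So the averaged law is absolutely continuous with respect to the noise,
  whereas a detector would make the two mutually singular.
\<close>

subsection \<open>Shifts of Gaussian noise\<close>

text \<open>The Cameron-Martin density: the likelihood ratio of \<open>x\<close> plus noise against
  noise, seen on the coordinates in \<open>J\<close>. Each real component of the noise has variance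
  1, so the real inner product on the complex numbers enters with no further factor.\<close>

definition shift_density :: "int set \<Rightarrow> (int \<Rightarrow> complex) \<Rightarrow> (int \<Rightarrow> complex) \<Rightarrow> real" where
  "shift_density J x \<omega> = exp (\<Sum>n\<in>J. x n \<bullet> \<omega> n - (cmod (x n))\<^sup>2 / 2)"

lemma std_normal_density_shift:
  "std_normal_density (x - a) = std_normal_density x * exp (a * x - a\<^sup>2 / 2)"
  by (simp add: std_normal_density_def mult_exp_exp power2_eq_square field_simps)

lemma nn_integral_std_normal_shift:
  fixes f :: "real \<Rightarrow> ennreal"
  assumes [measurable]: "f \<in> borel_measurable borel"
  shows "(\<integral>\<^sup>+x. f (a + x) \<partial>density lborel std_normal_density)
    = (\<integral>\<^sup>+x. exp (a * x - a\<^sup>2 / 2) * f x \<partial>density lborel std_normal_density)"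
proof -
  have "(\<integral>\<^sup>+x. f (a + x) \<partial>density lborel std_normal_density)
      = (\<integral>\<^sup>+x. std_normal_density x * f (a + x) \<partial>lborel)"
    by (simp add: nn_integral_density)
  also have "\<dots> = (\<integral>\<^sup>+x. std_normal_density (x - a) * f x \<partial>lborel)"
    by (subst (2) nn_integral_real_affine[where c = 1 and t = a]) auto
  also have "\<dots> = (\<integral>\<^sup>+x. exp (a * x - a\<^sup>2 / 2) * f x \<partial>density lborel std_normal_density)"
    unfolding std_normal_density_shift
    by (simp add: nn_integral_density ennreal_mult mult.assoc)
  finally show ?thesis .
qed

lemma nn_integral_std_complex_gaussian:
  fixes f :: "complex \<Rightarrow> ennreal"
  assumes [measurable]: "f \<in> borel_measurable borel"
  shows "(\<integral>\<^sup>+z. f z \<partial>std_complex_gaussian) = (\<integral>\<^sup>+u. (\<integral>\<^sup>+v. f (Complex u v)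
    \<partial>density lborel std_normal_density) \<partial>density lborel std_normal_density)"
proof -
  let ?N = "density lborel (\<lambda>x. ennreal (std_normal_density x))"
  interpret N: prob_space ?N by (rule prob_space_std_normal)
  have "(\<lambda>(u, v). Complex u v) \<in> borel_measurable (?N \<Otimes>\<^sub>M ?N)" by measurable
  then show ?thesis
    unfolding std_complex_gaussian_def
    by (subst nn_integral_distr) (auto simp: N.nn_integral_fst[symmetric])
qed

text \<open>The one-dimensional shift is applied to the imaginary and then to the real part; the two
  exponents add up to the complex one.\<close>

lemma nn_integral_complex_gaussian_shift:
  fixes f :: "complex \<Rightarrow> ennreal"
  assumes [measurable]: "f \<in> borel_measurable borel"
  shows "(\<integral>\<^sup>+z. f (c + z) \<partial>std_complex_gaussian)
    = (\<integral>\<^sup>+z. exp (c \<bullet> z - (cmod c)\<^sup>2 / 2) * f z \<partial>std_complex_gaussian)"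
proof -
  let ?N = "density lborel (\<lambda>x. ennreal (std_normal_density x))"
  interpret N: prob_space ?N by (rule prob_space_std_normal)
  let ?e = "\<lambda>a x::real. exp (a * x - a\<^sup>2 / 2)"
  have fm [measurable]: "(\<lambda>p. f (Complex (fst p) (snd p))) \<in> borel_measurable (borel \<Otimes>\<^sub>M borel)"
    using measurable_compose[OF measurable_Complex assms] by (simp add: case_prod_beta')
  have fC [measurable]: "(\<lambda>x. f (Complex (g x) (h x))) \<in> borel_measurable M"
    if [measurable]: "g \<in> borel_measurable M" "h \<in> borel_measurable M" for g h and M :: "'x measure"
    using measurable_compose[OF measurable_Pair[OF that] fm] by simp
  have "(\<integral>\<^sup>+z. f (c + z) \<partial>std_complex_gaussian)
      = (\<integral>\<^sup>+u. (\<integral>\<^sup>+v. f (Complex (Re c + u) (Im c + v)) \<partial>?N) \<partial>?N)"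
  proof -
    have "c + Complex u v = Complex (Re c + u) (Im c + v)" for u v
      by (simp add: complex_eq_iff)
    then show ?thesis by (subst nn_integral_std_complex_gaussian) auto
  qed
  also have "\<dots> = (\<integral>\<^sup>+u. (\<integral>\<^sup>+v. ?e (Im c) v * f (Complex (Re c + u) v) \<partial>?N) \<partial>?N)"
    by (rule nn_integral_cong, subst nn_integral_std_normal_shift
        [where f = "\<lambda>v. f (Complex (Re c + u) v)" for u]) auto
  also have "\<dots> = (\<integral>\<^sup>+u. ?e (Re c) u * (\<integral>\<^sup>+v. ?e (Im c) v * f (Complex u v) \<partial>?N) \<partial>?N)"
    by (subst nn_integral_std_normal_shift
        [where f = "\<lambda>u. (\<integral>\<^sup>+v. ?e (Im c) v * f (Complex u v) \<partial>?N)"]) auto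
  also have "\<dots> = (\<integral>\<^sup>+u. (\<integral>\<^sup>+v. ?e (Re c) u * (?e (Im c) v * f (Complex u v)) \<partial>?N) \<partial>?N)"
    by (rule nn_integral_cong, subst nn_integral_cmult) auto
  also have "\<dots> = (\<integral>\<^sup>+u. (\<integral>\<^sup>+v. exp (c \<bullet> Complex u v - (cmod c)\<^sup>2 / 2) * f (Complex u v) \<partial>?N) \<partial>?N)"
  proof -
    have "exp (c \<bullet> Complex u v - (cmod c)\<^sup>2 / 2) = ?e (Re c) u * ?e (Im c) v" for u v
      by (simp add: mult_exp_exp inner_complex_def cmod_power2 add_divide_distrib)
    then show ?thesis by (simp add: ennreal_mult mult.assoc)
  qed
  also have "\<dots> = (\<integral>\<^sup>+z. exp (c \<bullet> z - (cmod c)\<^sup>2 / 2) * f z \<partial>std_complex_gaussian)"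
    by (subst nn_integral_std_complex_gaussian) auto
  finally show ?thesis .
qed

lemma measurable_noise_component [measurable]: "(\<lambda>\<omega>. \<omega> n) \<in> borel_measurable noise"
  by (simp add: measurable_cong_sets[OF sets_noise refl])

lemma distr_noise_component: "distr noise borel (\<lambda>\<omega>. \<omega> n) = std_complex_gaussian"
proof -
  have "distr noise std_complex_gaussian (\<lambda>\<omega>. \<omega> n) = std_complex_gaussian"
    unfolding noise_def by (rule distr_PiM_component) (auto intro: prob_space_std_complex_gaussian)
  moreover have "distr noise std_complex_gaussian (\<lambda>\<omega>. \<omega> n) = distr noise borel (\<lambda>\<omega>. \<omega> n)"
    by (rule distr_cong) auto
  ultimately show ?thesis by simp
qed

lemma nn_integral_noise_prod:
  fixes f :: "int \<Rightarrow> complex \<Rightarrow> ennreal"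
  assumes "finite J" and [measurable]: "\<And>n. f n \<in> borel_measurable borel"
  shows "(\<integral>\<^sup>+\<omega>. (\<Prod>n\<in>J. f n (\<omega> n)) \<partial>noise) = (\<Prod>n\<in>J. \<integral>\<^sup>+z. f n z \<partial>std_complex_gaussian)"
proof -
  interpret prob_space noise by (rule prob_space_noise)
  have "indep_vars (\<lambda>_. borel) (\<lambda>n \<omega>. \<omega> n) (UNIV :: int set)"
    using noise_realises unfolding std_complex_noise_def by blast
  then have "indep_vars (\<lambda>_. borel) (\<lambda>n \<omega>. f n (\<omega> n)) J"
    by (rule indep_vars_compose2[OF indep_vars_subset[OF _ subset_UNIV]]) (rule assms(2))
  then have "(\<integral>\<^sup>+\<omega>. (\<Prod>n\<in>J. f n (\<omega> n)) \<partial>noise) = (\<Prod>n\<in>J. \<integral>\<^sup>+\<omega>. f n (\<omega> n) \<partial>noise)"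
    using assms(1) by (intro indep_vars_nn_integral) auto
  also have "\<dots> = (\<Prod>n\<in>J. \<integral>\<^sup>+z. f n z \<partial>std_complex_gaussian)"
  proof (intro prod.cong refl)
    show "(\<integral>\<^sup>+\<omega>. f n (\<omega> n) \<partial>noise) = (\<integral>\<^sup>+z. f n z \<partial>std_complex_gaussian)" for n
      using nn_integral_distr[of "\<lambda>\<omega>. \<omega> n" noise borel "f n"]
      by (simp add: distr_noise_component measurable_cong_sets[OF sets_std_complex_gaussian refl] assms(2))
  qed
  finally show ?thesis .
qed

lemma shift_density_nonneg [simp]: "0 \<le> shift_density J x \<omega>"
  by (simp add: shift_density_def)

lemma shift_density_measurable [measurable]: "shift_density J x \<in> borel_measurable noise"
  unfolding shift_density_def[abs_def] by measurable

lemma measurable_add_noise [measurable]: "(\<lambda>\<omega> n. x n + \<omega> n) \<in> measurable noise borel"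
  by (intro measurable_coordinatewise_then_product) measurable

text \<open>Both measures are determined by boxes restricting finitely many coordinates. On such a
  box either side factors by independence, and the factors agree by the shift formula for a single
  coordinate.\<close>

lemma distr_noise_shift:
  assumes J: "finite J" and x: "\<And>n. n \<notin> J \<Longrightarrow> x n = 0"
  shows "distr noise borel (\<lambda>\<omega> n. x n + \<omega> n) = density noise (shift_density J x)"
proof (rule measure_eqI_PiM_infinite[where I = UNIV and M = "\<lambda>_. borel"])
  interpret prob_space noise by (rule prob_space_noise)
  show "finite_measure (distr noise borel (\<lambda>\<omega> n. x n + \<omega> n))"
    by (intro prob_space.finite_measure prob_space_distr) measurable
  fix A :: "int \<Rightarrow> complex set" and I :: "int set"
  assume I: "finite I" and A: "\<And>i. i \<in> I \<Longrightarrow> A i \<in> sets borel"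
  define B where "B i = (if i \<in> I then A i else UNIV)" for i
  have B [measurable]: "B i \<in> sets borel" for i using A by (auto simp: B_def)
  let ?E = "prod_emb UNIV (\<lambda>_. borel) I (Pi\<^sub>E I A) :: (int \<Rightarrow> complex) set"
  have E: "?E = {\<omega>. \<forall>i\<in>I. \<omega> i \<in> A i}"
    by (auto simp: prod_emb_def PiE_def Pi_def)
  have Em [measurable]: "?E \<in> sets borel"
    using I A unfolding sets_PiM_equal_borel[symmetric] by (intro sets_PiM_I) auto
  have Em' [measurable]: "?E \<in> sets noise" by simp
  \<comment> \<open>The box lives on \<open>I\<close> and the density on \<open>J\<close>. Padding
    \<open>A\<close> with \<open>UNIV\<close> off \<open>I\<close>, and using \<open>x n = 0\<close>
    off \<open>J\<close>, lets both be written as products over one index set.\<close>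
  let ?K = "I \<union> J"
  have K: "finite ?K" using I J by auto
  have ind: "indicator ?E \<omega> = (\<Prod>n\<in>?K. indicator (B n) (\<omega> n) :: ennreal)" for \<omega>
  proof -
    have "(\<Prod>n\<in>?K. indicator (B n) (\<omega> n) :: ennreal) = (\<Prod>n\<in>I. indicator (A n) (\<omega> n))"
      using K by (intro prod.mono_neutral_cong_right) (auto simp: B_def)
    also have "\<dots> = indicator ?E \<omega>"
      using I by (auto simp: E indicator_def)
    finally show ?thesis by simp
  qed
  have dens: "ennreal (shift_density J x \<omega>)
      = (\<Prod>n\<in>?K. ennreal (exp (x n \<bullet> \<omega> n - (cmod (x n))\<^sup>2 / 2)))" for \<omega>
  proof -
    have "shift_density J x \<omega> = (\<Prod>n\<in>J. exp (x n \<bullet> \<omega> n - (cmod (x n))\<^sup>2 / 2))"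
      using J by (simp add: shift_density_def exp_sum)
    also have "\<dots> = (\<Prod>n\<in>?K. exp (x n \<bullet> \<omega> n - (cmod (x n))\<^sup>2 / 2))"
      using K x by (intro prod.mono_neutral_left) auto
    finally show ?thesis by (simp add: prod_ennreal)
  qed
  have "emeasure (distr noise borel (\<lambda>\<omega> n. x n + \<omega> n)) ?E
      = (\<integral>\<^sup>+\<omega>. indicator ?E (\<lambda>n. x n + \<omega> n) \<partial>noise)"
    using nn_integral_distr[OF measurable_add_noise, of "indicator ?E" x] by simp
  also have "\<dots> = (\<Prod>n\<in>?K. \<integral>\<^sup>+z. indicator (B n) (x n + z) \<partial>std_complex_gaussian)"
    unfolding ind using K by (intro nn_integral_noise_prod) auto
  also have "\<dots> = (\<Prod>n\<in>?K. \<integral>\<^sup>+z. ennreal (exp (x n \<bullet> z - (cmod (x n))\<^sup>2 / 2)) * indicator (B n) z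
      \<partial>std_complex_gaussian)"
    by (intro prod.cong refl nn_integral_complex_gaussian_shift) auto
  also have "\<dots> = (\<integral>\<^sup>+\<omega>. ennreal (shift_density J x \<omega>) * indicator ?E \<omega> \<partial>noise)"
    unfolding ind dens prod.distrib[symmetric]
    by (rule nn_integral_noise_prod[symmetric, OF K]) measurable
  also have "\<dots> = emeasure (density noise (shift_density J x)) ?E"
    by (subst emeasure_density) auto
  finally show "emeasure (distr noise borel (\<lambda>\<omega> n. x n + \<omega> n)) ?E
    = emeasure (density noise (shift_density J x)) ?E" .
next
  show "sets (distr noise borel (\<lambda>\<omega> n. x n + \<omega> n)) = sets (Pi\<^sub>M UNIV (\<lambda>_. borel))"
    by (simp only: sets_distr sets_PiM_equal_borel)
next
  show "sets (density noise (shift_density J x)) = sets (Pi\<^sub>M UNIV (\<lambda>_. borel))"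
    by (simp only: sets_density sets_noise sets_PiM_equal_borel)
qed

lemma nn_integral_shift_density:
  assumes "finite J"
  shows "(\<integral>\<^sup>+\<omega>. shift_density J x \<omega> \<partial>noise) = 1"
proof -
  interpret prob_space noise by (rule prob_space_noise)
  let ?x = "\<lambda>n. if n \<in> J then x n else 0"
  have eq: "shift_density J x = shift_density J ?x" by (auto simp: shift_density_def intro!: ext)
  have "prob_space (distr noise borel (\<lambda>\<omega> n. ?x n + \<omega> n))"
    by (intro prob_space_distr measurable_add_noise)
  then have "emeasure (density noise (shift_density J ?x)) UNIV = 1"
    using distr_noise_shift[OF assms, of ?x] prob_space.emeasure_space_1 by force
  then show ?thesis unfolding eq by (subst (asm) emeasure_density) auto
qed

text \<open>The Gaussian moment generating function, read off from the fact that
  \<open>shift_density\<close> has total mass 1.\<close>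

lemma nn_integral_exp_inner_noise:
  assumes "finite J"
  shows "(\<integral>\<^sup>+\<omega>. exp (\<Sum>n\<in>J. x n \<bullet> \<omega> n) \<partial>noise) = exp ((\<Sum>n\<in>J. (cmod (x n))\<^sup>2) / 2)"
proof -
  have "exp (\<Sum>n\<in>J. x n \<bullet> \<omega> n) = exp ((\<Sum>n\<in>J. (cmod (x n))\<^sup>2) / 2) * shift_density J x \<omega>" for \<omega>
    by (simp add: shift_density_def mult_exp_exp sum_subtractf sum_divide_distrib)
  then have "(\<integral>\<^sup>+\<omega>. exp (\<Sum>n\<in>J. x n \<bullet> \<omega> n) \<partial>noise)
      = (\<integral>\<^sup>+\<omega>. ennreal (exp ((\<Sum>n\<in>J. (cmod (x n))\<^sup>2) / 2)) * shift_density J x \<omega> \<partial>noise)"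
    by (simp add: ennreal_mult)
  then show ?thesis
    using assms by (simp add: nn_integral_cmult nn_integral_shift_density)
qed

text \<open>Chernoff's bound for a Gaussian of variance \<open>V\<close> at level
  \<open>V / 4\<close>. The best exponential parameter is level over variance, that is 1/4, which
  explains \<open>?y\<close> and the exponent \<open>- V / 16 + V / 32\<close>.\<close>

lemma inner_noise_tail:
  assumes "finite J" and V: "(\<Sum>n\<in>J. (cmod (x n))\<^sup>2) = V"
  shows "measure noise {\<omega>. V / 4 \<le> (\<Sum>n\<in>J. x n \<bullet> \<omega> n)} \<le> exp (- V / 32)"
proof -
  interpret prob_space noise by (rule prob_space_noise)
  let ?y = "\<lambda>n. x n /\<^sub>R 4"
  have "indicator {\<omega>. V / 4 \<le> (\<Sum>n\<in>J. x n \<bullet> \<omega> n)} \<omega>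
     \<le> ennreal (exp (- V / 16)) * ennreal (exp (\<Sum>n\<in>J. ?y n \<bullet> \<omega> n))" for \<omega>
  proof (cases "V / 4 \<le> (\<Sum>n\<in>J. x n \<bullet> \<omega> n)")
    case True
    then have "1 \<le> exp (- V / 16) * exp (\<Sum>n\<in>J. ?y n \<bullet> \<omega> n)"
      by (simp add: mult_exp_exp sum_divide_distrib[symmetric] divide_inverse_commute[symmetric]
          sum_distrib_left[symmetric])
    then show ?thesis
      using True by (simp add: ennreal_mult[symmetric] flip: ennreal_1)
  qed simp
  then have "(\<integral>\<^sup>+\<omega>. indicator {\<omega>. V / 4 \<le> (\<Sum>n\<in>J. x n \<bullet> \<omega> n)} \<omega> \<partial>noise)
     \<le> (\<integral>\<^sup>+\<omega>. ennreal (exp (- V / 16)) * ennreal (exp (\<Sum>n\<in>J. ?y n \<bullet> \<omega> n)) \<partial>noise)"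
    by (intro nn_integral_mono)
  also have "\<dots> = ennreal (exp (- V / 16) * exp ((\<Sum>n\<in>J. (cmod (?y n))\<^sup>2) / 2))"
    using assms(1) by (subst nn_integral_cmult)
      (auto simp: nn_integral_exp_inner_noise ennreal_mult simp del: inner_scaleR_left)
  also have "(\<Sum>n\<in>J. (cmod (?y n))\<^sup>2) = V / 16"
    by (simp add: V[symmetric] power_mult_distrib sum_divide_distrib power2_eq_square)
  also have "exp (- V / 16) * exp (V / 16 / 2) = exp (- V / 32)"
    by (simp add: mult_exp_exp)
  finally show ?thesis by (subst (asm) nn_integral_indicator) (auto simp: emeasure_eq_measure)
qed

subsection \<open>Cosine sums with decreasing coefficients\<close>

text \<open>Summation by parts moves the differences onto \<open>c\<close>. They are nonnegative and
  telescope, so the uniform bound on the partial sums is paid for only once, with weight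
  \<open>c m\<close>.\<close>

lemma abel_summation_bound:
  fixes c a :: "nat \<Rightarrow> real"
  assumes dec: "\<And>n. m \<le> n \<Longrightarrow> c (Suc n) \<le> c n" and nonneg: "\<And>n. 0 \<le> c n"
    and partial: "\<And>N. \<bar>\<Sum>n=m..<N. a n\<bar> \<le> B"
  shows "\<bar>\<Sum>n=m..<k. c n * a n\<bar> \<le> c m * B"
proof (cases "m \<le> k")
  case True
  let ?A = "\<lambda>N. \<Sum>n=m..<N. a n"
  have abel: "(\<Sum>n=m..<k. c n * a n) = c k * ?A k + (\<Sum>n=m..<k. (c n - c (Suc n)) * ?A (Suc n))"
    using True by (induction k rule: dec_induct) (auto simp: algebra_simps)
  have tele: "(\<Sum>n=m..<k. c n - c (Suc n)) = c m - c k"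
    using True by (induction k rule: dec_induct) auto
  have "\<bar>\<Sum>n=m..<k. c n * a n\<bar> \<le> \<bar>c k * ?A k\<bar> + (\<Sum>n=m..<k. \<bar>(c n - c (Suc n)) * ?A (Suc n)\<bar>)"
    unfolding abel by (rule order_trans[OF abs_triangle_ineq add_left_mono[OF sum_abs]])
  also have "\<dots> \<le> c k * B + (\<Sum>n=m..<k. (c n - c (Suc n)) * B)"
    using partial nonneg dec
    by (intro add_mono sum_mono) (auto simp: abs_mult simp del: sum.op_ivl_Suc intro!: mult_mono)
  also have "\<dots> = c m * B"
    unfolding sum_distrib_right[symmetric] tele by (simp add: algebra_simps)
  finally show ?thesis .
next
  case False
  have "0 \<le> B" using partial[of m] by simp
  then show ?thesis using False nonneg[of m] by simp
qed

text \<open>The Dirichlet kernel argument: multiplication by \<open>2 * sin (pi * u)\<close> makes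
  the sum telescope to a difference of two sines.\<close>

lemma sum_cos_bound:
  assumes "sin (pi * u) \<noteq> 0"
  shows "\<bar>\<Sum>n=m..<N. cos (2 * pi * real n * u)\<bar> \<le> 1 / \<bar>sin (pi * u)\<bar>"
proof (cases "m \<le> N")
  case True
  have "2 * sin (pi * u) * (\<Sum>n=m..<N. cos (2 * pi * real n * u))
      = sin (2 * pi * real N * u - pi * u) - sin (2 * pi * real m * u - pi * u)"
    using True
  proof (induction N rule: dec_induct)
    case (step N)
    have "2 * sin (pi * u) * cos (2 * pi * real N * u)
        = sin (2 * pi * real N * u + pi * u) - sin (2 * pi * real N * u - pi * u)"
      by (simp add: sin_add sin_diff)
    moreover have "2 * pi * real (Suc N) * u - pi * u = 2 * pi * real N * u + pi * u"
      by (simp add: algebra_simps)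
    ultimately show ?case using step by (simp add: distrib_left ac_simps del: of_nat_Suc)
  qed simp
  also have "\<bar>\<dots>\<bar> \<le> 2"
    by (rule order_trans[OF abs_triangle_ineq4]) (intro order_trans[OF add_mono[OF abs_sin_le_one abs_sin_le_one]], simp)
  finally show ?thesis using assms by (simp add: abs_mult field_simps)
qed simp

lemma cos_ge_parabola: "1 - x\<^sup>2 / 2 \<le> cos x" for x :: real
proof -
  have "(sin (x / 2))\<^sup>2 \<le> (x / 2)\<^sup>2"
    by (metis abs_ge_zero abs_sin_x_le_abs_x power2_abs power_mono)
  then show ?thesis
    using cos_double_sin[of "x / 2"] by (simp add: power2_eq_square)
qed

text \<open>Jordan's inequality: sine is concave on \<open>{0..pi / 2}\<close> and hence lies above
  its chord.\<close>

lemma sin_ge_linear: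
  assumes "0 \<le> u" "u \<le> 1 / 2"
  shows "2 * u \<le> sin (pi * u)"
proof -
  have "convex_on {0..pi / 2} (\<lambda>x. - sin x)"
    by (rule f''_ge0_imp_convex[where f' = "\<lambda>x. - cos x" and f'' = sin])
      (auto intro!: derivative_eq_intros sin_ge_zero)
  from convex_onD_Icc'[OF this, of "pi * u"] assms
  show ?thesis by (simp add: field_simps)
qed

lemma sum_decreasing_cos_bound:
  fixes c :: "nat \<Rightarrow> real"
  assumes "\<And>n. m \<le> n \<Longrightarrow> c (Suc n) \<le> c n" "\<And>n. 0 \<le> c n" "sin (pi * u) \<noteq> 0"
  shows "\<bar>\<Sum>n=m..<k. c n * cos (2 * pi * real n * u)\<bar> \<le> c m / \<bar>sin (pi * u)\<bar>"
  using abel_summation_bound[where c = c and m = m and k = k, OF assms(1,2) sum_cos_bound[OF assms(3)]]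
  by simp

section \<open>Sums over symmetric frequency windows\<close>

definition window :: "nat \<Rightarrow> int set" where
  "window k = {n. \<bar>n\<bar> < int k}"

lemma finite_window [simp]: "finite (window k)"
  by (rule finite_subset[of _ "{- int k..int k}"]) (auto simp: window_def)

lemma window_mono: "j \<le> k \<Longrightarrow> window j \<subseteq> window k"
  by (auto simp: window_def)

text \<open>For \<open>k = 0\<close> the two new indices would coincide and the index 0 would be
  counted twice.\<close>

lemma sum_window_Suc:
  fixes f :: "int \<Rightarrow> 'a::comm_monoid_add"
  assumes "0 < k"
  shows "(\<Sum>n\<in>window (Suc k). f n) = (\<Sum>n\<in>window k. f n) + (f (int k) + f (- int k))"
proof -
  have "window (Suc k) = insert (int k) (insert (- int k) (window k))"
    by (auto simp: window_def)
  then show ?thesis using assms by (simp add: window_def ac_simps finite_window[unfolded window_def])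
qed

lemma sum_window_split:
  fixes f :: "int \<Rightarrow> 'a::comm_monoid_add"
  assumes "0 < m" "m \<le> k"
  shows "(\<Sum>n\<in>window k. f n)
    = (\<Sum>n\<in>window m. f n) + (\<Sum>n=m..<k. f (int n)) + (\<Sum>n=m..<k. f (- int n))"
  using assms(2,1)
  by (induction k rule: dec_induct) (auto simp: sum_window_Suc ac_simps)

section \<open>Energy and correlation of decreasing coefficients\<close>

locale decreasing_coefficients =
  fixes \<sigma> :: "int \<Rightarrow> complex"
  assumes decreasing_right: "\<And>n. 0 \<le> n \<Longrightarrow> cmod (\<sigma> (n + 1)) \<le> cmod (\<sigma> n)"
    and decreasing_left: "\<And>n. n \<le> 0 \<Longrightarrow> cmod (\<sigma> (n - 1)) \<le> cmod (\<sigma> n)"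
begin

definition energy :: "nat \<Rightarrow> real" where
  "energy k = (\<Sum>n\<in>window k. (cmod (\<sigma> n))\<^sup>2)"

text \<open>By \<open>inner_trig_signal\<close> this is the inner product, over the window, of two
  signals whose times differ by \<open>u\<close>.\<close>

definition correlation :: "nat \<Rightarrow> real \<Rightarrow> real" where
  "correlation k u = (\<Sum>n\<in>window k. (cmod (\<sigma> n))\<^sup>2 * cos (2 * pi * of_int n * u))"

lemma energy_nonneg [simp]: "0 \<le> energy k"
  unfolding energy_def by (intro sum_nonneg) auto

lemma energy_mono: "j \<le> k \<Longrightarrow> energy j \<le> energy k"
  unfolding energy_def by (intro sum_mono2 window_mono) auto

lemma correlation_minus [simp]: "correlation k (- u) = correlation k u"
  by (simp add: correlation_def)

lemma correlation_le_energy: "correlation k u \<le> energy k"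
  unfolding correlation_def energy_def by (intro sum_mono) (simp add: mult_left_le)

lemma right_antimono: "m \<le> n \<Longrightarrow> (cmod (\<sigma> (int n)))\<^sup>2 \<le> (cmod (\<sigma> (int m)))\<^sup>2"
proof (induction n rule: dec_induct)
  case (step n)
  have "(cmod (\<sigma> (int n + 1)))\<^sup>2 \<le> (cmod (\<sigma> (int n)))\<^sup>2"
    by (intro power_mono decreasing_right) auto
  with step.IH have "(cmod (\<sigma> (int n + 1)))\<^sup>2 \<le> (cmod (\<sigma> (int m)))\<^sup>2" by (rule order_trans[rotated])
  then show ?case by (simp add: add.commute)
qed simp

lemma left_antimono: "m \<le> n \<Longrightarrow> (cmod (\<sigma> (- int n)))\<^sup>2 \<le> (cmod (\<sigma> (- int m)))\<^sup>2"
proof (induction n rule: dec_induct)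
  case (step n)
  have "(cmod (\<sigma> (- int n - 1)))\<^sup>2 \<le> (cmod (\<sigma> (- int n)))\<^sup>2"
    by (intro power_mono decreasing_left) auto
  with step.IH have "(cmod (\<sigma> (- int n - 1)))\<^sup>2 \<le> (cmod (\<sigma> (- int m)))\<^sup>2" by (rule order_trans[rotated])
  moreover have "- int (Suc n) = - int n - 1" by simp
  ultimately show ?case by (simp only:)
qed simp

lemma tail_bounds:
  assumes "sin (pi * u) \<noteq> 0"
  shows "\<bar>\<Sum>n=m..<k. (cmod (\<sigma> (int n)))\<^sup>2 * cos (2 * pi * of_int (int n) * u)\<bar>
      \<le> (cmod (\<sigma> (int m)))\<^sup>2 / \<bar>sin (pi * u)\<bar>"
    and "\<bar>\<Sum>n=m..<k. (cmod (\<sigma> (- int n)))\<^sup>2 * cos (2 * pi * of_int (- int n) * u)\<bar>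
      \<le> (cmod (\<sigma> (- int m)))\<^sup>2 / \<bar>sin (pi * u)\<bar>"
  using sum_decreasing_cos_bound[of m "\<lambda>n. (cmod (\<sigma> (int n)))\<^sup>2" u k]
    sum_decreasing_cos_bound[of m "\<lambda>n. (cmod (\<sigma> (- int n)))\<^sup>2" u k]
    right_antimono left_antimono assms by (auto simp del: of_nat_Suc)

text \<open>Frequencies below \<open>m\<close> are bounded trivially by their energy, and the two
  tails by Abel summation. The bound does not depend on \<open>k\<close>.\<close>

lemma correlation_split:
  assumes "sin (pi * u) \<noteq> 0" "0 < m"
  shows "correlation k u \<le> energy m
    + ((cmod (\<sigma> (int m)))\<^sup>2 + (cmod (\<sigma> (- int m)))\<^sup>2) / \<bar>sin (pi * u)\<bar>"
proof (cases "m \<le> k")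
  case True
  show ?thesis
    using tail_bounds[OF assms(1), of m k] correlation_le_energy[of m u]
    unfolding correlation_def sum_window_split[OF assms(2) True] add_divide_distrib
    by linarith
next
  case False
  then have "correlation k u \<le> energy m"
    using correlation_le_energy[of k u] energy_mono[of k m] by simp
  then show ?thesis by (rule order_trans) simp
qed

text \<open>The split at \<open>m = 1\<close>. As the bound is free of \<open>k\<close>, a
  correlation comparable to a diverging energy forces \<open>sin (pi * u)\<close> to be
  small.\<close>

lemma correlation_far:
  assumes "sin (pi * u) \<noteq> 0"
  shows "correlation k u \<le> (cmod (\<sigma> 0))\<^sup>2 + 2 * (cmod (\<sigma> 0))\<^sup>2 / \<bar>sin (pi * u)\<bar>"
proof -
  have "window 1 = {0}" by (auto simp: window_def)
  then have "energy 1 = (cmod (\<sigma> 0))\<^sup>2" by (simp add: energy_def)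
  moreover have "(cmod (\<sigma> (int 1)))\<^sup>2 + (cmod (\<sigma> (- int 1)))\<^sup>2 \<le> 2 * (cmod (\<sigma> 0))\<^sup>2"
    using add_mono[OF right_antimono[of 0 1] left_antimono[of 0 1]] by simp
  ultimately show ?thesis
    using correlation_split[OF assms, of 1 k]
      divide_right_mono[of _ "2 * (cmod (\<sigma> 0))\<^sup>2" "\<bar>sin (pi * u)\<bar>"] by fastforce
qed

text \<open>At such a small \<open>u\<close> every phase in the window is at most 1/2, so every
  cosine is at least 7/8.\<close>

lemma correlation_near:
  assumes u: "16 * real k * \<bar>u\<bar> \<le> 1"
  shows "3 / 4 * energy k \<le> correlation k u"
proof -
  have "3 / 4 \<le> cos (2 * pi * of_int n * u)" if "n \<in> window k" for n
  proof -
    let ?x = "2 * pi * of_int n * u"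
    have n: "\<bar>of_int n\<bar> \<le> real k" using that by (simp add: window_def)
    have "\<bar>?x\<bar> = 2 * pi * (\<bar>of_int n\<bar> * \<bar>u\<bar>)" by (simp add: abs_mult)
    also have "\<dots> \<le> 2 * pi * (real k * \<bar>u\<bar>)"
      by (intro mult_left_mono mult_right_mono n) auto
    also have "\<dots> \<le> 2 * 4 * (real k * \<bar>u\<bar>)"
      using pi_less_4 by (intro mult_right_mono mult_left_mono) auto
    also have "\<dots> \<le> 1 / 2" using u by simp
    finally have "\<bar>?x\<bar> \<le> 1 / 2" .
    then have "?x\<^sup>2 \<le> (1 / 2)\<^sup>2" by (metis abs_ge_zero power2_abs power_mono)
    then have "?x\<^sup>2 \<le> 1 / 4" by (simp only: power_divide power_one) simp
    moreover have "1 - ?x\<^sup>2 / 2 \<le> cos ?x" by (rule cos_ge_parabola)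
    ultimately show ?thesis by linarith
  qed
  then show ?thesis
    unfolding correlation_def energy_def sum_distrib_left
    by (intro sum_mono) (metis mult.commute mult_left_mono zero_le_power2)
qed

text \<open>On either side of the origin the \<open>m\<close> coefficients of index below
  \<open>m\<close> are at least as large as the one at \<open>m\<close>.\<close>

lemma index_mult_coefficient_le_energy:
  "real m * (cmod (\<sigma> (int m)))\<^sup>2 \<le> energy m" "real m * (cmod (\<sigma> (- int m)))\<^sup>2 \<le> energy m"
proof -
  have "real m * (cmod (\<sigma> (int m)))\<^sup>2 \<le> (\<Sum>n<m. (cmod (\<sigma> (int n)))\<^sup>2)"
    using sum_mono[of "{..<m}" "\<lambda>_. (cmod (\<sigma> (int m)))\<^sup>2"] right_antimono by simp
  also have "\<dots> = (\<Sum>n\<in>int ` {..<m}. (cmod (\<sigma> n))\<^sup>2)"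
    by (simp add: sum.reindex)
  also have "\<dots> \<le> energy m"
    unfolding energy_def by (intro sum_mono2) (auto simp: window_def finite_window[unfolded window_def])
  finally show "real m * (cmod (\<sigma> (int m)))\<^sup>2 \<le> energy m" .
  have "real m * (cmod (\<sigma> (- int m)))\<^sup>2 \<le> (\<Sum>n<m. (cmod (\<sigma> (- int n)))\<^sup>2)"
    using sum_mono[of "{..<m}" "\<lambda>_. (cmod (\<sigma> (- int m)))\<^sup>2"] left_antimono by simp
  also have "\<dots> = (\<Sum>n\<in>(\<lambda>n. - int n) ` {..<m}. (cmod (\<sigma> n))\<^sup>2)"
    by (subst sum.reindex) (auto simp: inj_on_def)
  also have "\<dots> \<le> energy m"
    unfolding energy_def by (intro sum_mono2) (auto simp: window_def finite_window[unfolded window_def])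
  finally show "real m * (cmod (\<sigma> (- int m)))\<^sup>2 \<le> energy m" .
qed

text \<open>The tail beyond \<open>1 / |u|\<close> oscillates and costs no more than the energy up to \<open>1 / |u|\<close>.\<close>

lemma correlation_le_energy_inverse:
  assumes "0 < \<bar>u\<bar>" "\<bar>u\<bar> \<le> 1 / 2"
  shows "correlation k u \<le> 2 * energy (nat \<lceil>1 / \<bar>u\<bar>\<rceil>)"
proof -
  define m where "m = nat \<lceil>1 / \<bar>u\<bar>\<rceil>"
  have m: "1 / \<bar>u\<bar> \<le> real m" by (simp add: m_def real_nat_ceiling_ge)
  have s: "2 * \<bar>u\<bar> \<le> sin (pi * \<bar>u\<bar>)" using assms by (intro sin_ge_linear) auto
  then have s0: "0 < sin (pi * \<bar>u\<bar>)" using assms by linarith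
  have "0 < m" using m assms by (cases m) auto
  have "1 / sin (pi * \<bar>u\<bar>) \<le> 1 / (2 * \<bar>u\<bar>)"
    using s s0 assms by (intro divide_left_mono) auto
  also have "\<dots> \<le> real m / 2" using m by simp
  finally have inv: "1 / sin (pi * \<bar>u\<bar>) \<le> real m / 2" .
  let ?d = "(cmod (\<sigma> (int m)))\<^sup>2 + (cmod (\<sigma> (- int m)))\<^sup>2"
  have "correlation k \<bar>u\<bar> \<le> energy m + ?d / sin (pi * \<bar>u\<bar>)"
    using correlation_split[of "\<bar>u\<bar>" m k] s0 \<open>0 < m\<close> by simp
  \<comment> \<open>\<open>1 / sin\<close> costs at most \<open>m / 2\<close>, so each of the two
    boundary coefficients contributes at most half of \<open>energy m\<close>.\<close>
  also have "?d / sin (pi * \<bar>u\<bar>) \<le> ?d * (real m / 2)"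
    using mult_left_mono[OF inv, of ?d] by simp
  also have "\<dots> \<le> energy m"
    using index_mult_coefficient_le_energy[of m] by (simp add: algebra_simps)
  finally have "correlation k \<bar>u\<bar> \<le> 2 * energy m" by simp
  then show ?thesis by (cases "0 \<le> u") (auto simp: m_def)
qed

end

subsection \<open>Impossibility of detection\<close>

lemma shift_density_mult:
  "shift_density J x \<omega> * shift_density J y \<omega>
    = exp (\<Sum>n\<in>J. x n \<bullet> y n) * shift_density J (\<lambda>n. x n + y n) \<omega>"
proof -
  have "x n \<bullet> \<omega> n - (cmod (x n))\<^sup>2 / 2 + (y n \<bullet> \<omega> n - (cmod (y n))\<^sup>2 / 2)
    = x n \<bullet> y n + ((x n + y n) \<bullet> \<omega> n - (cmod (x n + y n))\<^sup>2 / 2)" for n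
    by (simp add: power2_norm_eq_inner inner_add inner_commute field_simps)
  then show ?thesis
    by (simp add: shift_density_def mult_exp_exp sum.distrib[symmetric])
qed

text \<open>The product of two likelihood ratios is a constant times the ratio for the shift
  \<open>x + y\<close>, which has mass 1. Averaged over both times, this gives the second moment of
  the mixture's likelihood ratio.\<close>

lemma nn_integral_shift_density_mult:
  assumes "finite J"
  shows "(\<integral>\<^sup>+\<omega>. ennreal (shift_density J x \<omega>) * shift_density J y \<omega> \<partial>noise) = exp (\<Sum>n\<in>J. x n \<bullet> y n)"
  using assms
  by (simp add: ennreal_mult[symmetric] shift_density_mult)
    (simp add: ennreal_mult nn_integral_cmult nn_integral_shift_density)

section \<open>Cylinder sets and their use for open sets\<close>

definition cylinder :: "nat \<Rightarrow> (int \<Rightarrow> complex) set \<Rightarrow> bool" where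
  "cylinder k A \<longleftrightarrow> (\<forall>x y. (\<forall>n\<in>window k. x n = y n) \<longrightarrow> (x \<in> A \<longleftrightarrow> y \<in> A))"

lemma cylinder_mono: "cylinder j A \<Longrightarrow> j \<le> k \<Longrightarrow> cylinder k A"
  using window_mono[of j k] unfolding cylinder_def by blast

lemma cylinder_empty: "cylinder k {}"
  by (simp add: cylinder_def)

lemma cylinder_Un: "cylinder k A \<Longrightarrow> cylinder k B \<Longrightarrow> cylinder k (A \<union> B)"
  unfolding cylinder_def by blast

lemma finite_subset_window:
  assumes "finite J"
  shows "\<exists>k. J \<subseteq> window k"
proof -
  have "0 \<le> Max (insert 0 (abs ` J))" using assms by (intro Max_ge) auto
  have "J \<subseteq> window (nat (Max (insert 0 (abs ` J))) + 1)"
  proof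
    fix n assume "n \<in> J"
    then have "\<bar>n\<bar> \<le> Max (insert 0 (abs ` J))" using assms by (intro Max_ge) auto
    then show "n \<in> window (nat (Max (insert 0 (abs ` J))) + 1)"
      using \<open>0 \<le> Max _\<close> by (simp add: window_def)
  qed
  then show ?thesis ..
qed

text \<open>Likelihood ratios are used only on finite windows, so estimates are proved for cylinders
  and passed to open sets by monotone limits. The sets \<open>A m\<close> are finite unions of basic
  boxes; such a union need not be a box, but it is still a cylinder.\<close>

lemma open_eq_Union_cylinders:
  fixes U :: "(int \<Rightarrow> complex) set"
  assumes "open U"
  obtains A where "incseq A" "\<And>m. open (A m)" "\<And>m. \<exists>k. cylinder k (A m)" "U = (\<Union>m. A m)"
proof -
  obtain K :: "(int \<Rightarrow> complex) set set" where K: "topological_basis K" "countable K"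
    and box: "\<And>B. B \<in> K \<Longrightarrow> \<exists>X. B = Pi\<^sub>E UNIV X \<and> (\<forall>i. open (X i)) \<and> finite {i. X i \<noteq> UNIV}"
    using product_topology_countable_basis by blast
  have cyl: "\<exists>k. cylinder k B" if BK: "B \<in> K" for B
  proof -
    obtain X where X: "B = Pi\<^sub>E UNIV X" "finite {i. X i \<noteq> UNIV}" using box[OF BK] by blast
    then obtain k where "{i. X i \<noteq> UNIV} \<subseteq> window k" using finite_subset_window by blast
    moreover have "x \<in> B \<longleftrightarrow> (\<forall>i\<in>{i. X i \<noteq> UNIV}. x i \<in> X i)" for x
      by (auto simp: X(1) PiE_iff)
    ultimately have "cylinder k B" unfolding cylinder_def by (metis (mono_tags, lifting) subsetD)
    then show ?thesis ..
  qed
  obtain K' where K': "K' \<subseteq> K" "\<Union>K' = U" using K(1) assms by (auto simp: topological_basis_def)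
  \<comment> \<open>Inserting the empty set keeps the enumeration valid when \<open>K'\<close> is
    empty.\<close>
  define C where "C = from_nat_into (insert {} K')"
  have "countable (insert {} K')" using K' K(2) by (auto intro: countable_subset)
  then have ran: "range C = insert {} K'" unfolding C_def by (intro range_from_nat_into) auto
  define A where "A m = (\<Union>i<m. C i)" for m :: nat
  have C: "open (C i)" "\<exists>k. cylinder k (C i)" for i
  proof -
    have "C i \<in> insert {} K'" using ran by blast
    then show "open (C i)" "\<exists>k. cylinder k (C i)"
      using K' K(1) cyl cylinder_empty by (auto dest: topological_basis_open)
  qed
  show thesis
  proof
    show "incseq A" by (auto simp: A_def incseq_def) (metis lessThan_iff order_less_le_trans)
    show "open (A m)" for m using C by (auto simp: A_def)
    show "\<exists>k. cylinder k (A m)" for m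
    proof (induction m)
      case 0
      show ?case using cylinder_empty by (auto simp: A_def)
    next
      case (Suc m)
      then obtain j k where "cylinder j (A m)" "cylinder k (C m)" using C by blast
      then have "cylinder (max j k) (C m \<union> A m)"
        by (intro cylinder_Un) (auto elim: cylinder_mono)
      then show ?case by (auto simp: A_def lessThan_Suc)
    qed
    have "(\<Union>m. A m) = \<Union> (range C)" by (auto simp: A_def)
    then show "U = (\<Union>m. A m)" using ran K'(2) by simp
  qed
qed

text \<open>A cylinder does not see the signal outside its window. The signal may therefore be
  truncated there, after which the Cameron-Martin density is available even if the full signal has
  infinite energy.\<close>

lemma nn_integral_shifted_cylinder:
  assumes A: "A \<in> sets borel" "cylinder k A"
  shows "(\<integral>\<^sup>+\<omega>. indicator A (\<lambda>n. x n + \<omega> n) \<partial>noise)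
    = (\<integral>\<^sup>+\<omega>. indicator A \<omega> * ennreal (shift_density (window k) x \<omega>) \<partial>noise)"
proof -
  define y where "y n = (if n \<in> window k then x n else 0)" for n
  have A' [measurable]: "A \<in> sets noise" "A \<in> sets borel" using A by auto
  have "(\<lambda>n. x n + \<omega> n) \<in> A \<longleftrightarrow> (\<lambda>n. y n + \<omega> n) \<in> A" for \<omega>
    using A(2) unfolding cylinder_def by (auto simp: y_def)
  then have "(\<integral>\<^sup>+\<omega>. indicator A (\<lambda>n. x n + \<omega> n) \<partial>noise) = (\<integral>\<^sup>+\<omega>. indicator A (\<lambda>n. y n + \<omega> n) \<partial>noise)"
    by (simp add: indicator_def)
  also have "\<dots> = (\<integral>\<^sup>+\<omega>. indicator A \<omega> \<partial>distr noise borel (\<lambda>\<omega> n. y n + \<omega> n))"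
    using nn_integral_distr[OF measurable_add_noise, of "indicator A" y] by simp
  also have "distr noise borel (\<lambda>\<omega> n. y n + \<omega> n) = density noise (shift_density (window k) y)"
    by (rule distr_noise_shift) (auto simp: y_def)
  also have "shift_density (window k) y = shift_density (window k) x"
    by (auto simp: shift_density_def y_def)
  also have "(\<integral>\<^sup>+\<omega>. indicator A \<omega> \<partial>density noise (shift_density (window k) x))
      = (\<integral>\<^sup>+\<omega>. indicator A \<omega> * ennreal (shift_density (window k) x \<omega>) \<partial>noise)"
    by (subst nn_integral_density) (auto simp: mult.commute)
  finally show ?thesis .
qed

section \<open>Trigonometric signals and integrals over time\<close>

lemma trig_signal_cis: "trig_signal \<sigma> t n = cis (2 * pi * of_int n * t) * \<sigma> n"
  by (simp add: trig_signal_def cis_conv_exp mult_ac)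

lemma inner_trig_signal:
  "trig_signal \<sigma> s n \<bullet> trig_signal \<sigma> t n = (cmod (\<sigma> n))\<^sup>2 * cos (2 * pi * of_int n * (s - t))"
proof -
  have "(cis a * z) \<bullet> (cis b * z) = (cmod z)\<^sup>2 * cos (a - b)" for a b z
    unfolding cmod_power2 cos_diff inner_complex_def by (simp add: algebra_simps power2_eq_square)
  then show ?thesis by (simp add: trig_signal_cis right_diff_distrib)
qed

lemma norm_trig_signal [simp]: "cmod (trig_signal \<sigma> t n) = cmod (\<sigma> n)"
  by (simp add: trig_signal_cis norm_mult)

lemma measurable_trig_signal [measurable]:
  assumes "f \<in> borel_measurable M"
  shows "(\<lambda>x. trig_signal \<sigma> (f x) n) \<in> borel_measurable M"
proof -
  have "continuous_on UNIV (\<lambda>t. trig_signal \<sigma> t n)"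
    unfolding trig_signal_def by (intro continuous_intros)
  then show ?thesis
    using measurable_compose[OF assms] borel_measurable_continuous_onI by blast
qed

text \<open>The exponent exceeds -1, so the singularity at 0 is integrable; the negative half is the
  mirror image of the positive one.\<close>

lemma nn_integral_powr_minus_half:
  "(\<integral>\<^sup>+u. ennreal (\<bar>u\<bar> powr (- 1 / 2)) * indicator {- 1 / 2..1 / 2} u \<partial>lborel) < \<infinity>"
proof -
  let ?h = "\<lambda>u::real. ennreal (u powr (- 1 / 2)) * indicator {0..1 / 2} u"
  have h: "(\<integral>\<^sup>+u. ?h u \<partial>lborel) < \<infinity>"
    using nn_integral_has_integral_lebesgue'[OF _ has_integral_powr_from_0[of "- 1 / 2" "1 / 2"]] by simp
  have "(\<integral>\<^sup>+u. ennreal (\<bar>u\<bar> powr (- 1 / 2)) * indicator {- 1 / 2..1 / 2} u \<partial>lborel)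
      \<le> (\<integral>\<^sup>+u. ?h u + ?h (- u) \<partial>lborel)"
    by (intro nn_integral_mono) (auto simp: indicator_def abs_if)
  also have "\<dots> = (\<integral>\<^sup>+u. ?h u \<partial>lborel) + (\<integral>\<^sup>+u. ?h (- u) \<partial>lborel)"
    by (rule nn_integral_add) auto
  also have "(\<integral>\<^sup>+u. ?h (- u) \<partial>lborel) = (\<integral>\<^sup>+u. ?h u \<partial>lborel)"
    using nn_integral_real_affine[of ?h "- 1" 0] by simp
  finally show ?thesis using h by (simp add: order_le_less_trans)
qed

text \<open>On \<open>[0, 1/2]\<close> differences \<open>t - s\<close> do not wrap around the circle, so the correlation has a
  single peak, at \<open>t = s\<close>.\<close>

definition prior :: "real measure" where
  "prior = uniform_measure lborel {0..1 / 2}"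

lemma sets_prior [simp, measurable_cong]: "sets prior = sets borel"
  by (simp add: prior_def)

lemma prob_space_prior: "prob_space prior"
  unfolding prior_def by (rule prob_space_uniform_measure) auto

lemma nn_integral_prior:
  assumes [measurable]: "f \<in> borel_measurable borel"
  shows "(\<integral>\<^sup>+t. f t \<partial>prior) = 2 * (\<integral>\<^sup>+t. f t * indicator {0..1 / 2} t \<partial>lborel)"
proof -
  have "inverse (ennreal (1 / 2)) = 2" by (subst inverse_ennreal) auto
  then show ?thesis
    unfolding prior_def by (subst nn_integral_uniform_measure)
      (auto simp: divide_ennreal_def mult.commute)
qed

section \<open>The averaged law of signal plus noise\<close>

context decreasing_coefficients begin

lemma correlation_log_bound:
  assumes "limsup (\<lambda>k. ereal (1 / ln (real k) * energy k)) < ereal (1 / 4)"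
  obtains C where "\<And>k u. 0 < \<bar>u\<bar> \<Longrightarrow> \<bar>u\<bar> \<le> 1 / 2 \<Longrightarrow> correlation k u \<le> C + ln (2 / \<bar>u\<bar>) / 2"
proof -
  have "eventually (\<lambda>k. ereal (1 / ln (real k) * energy k) < ereal (1 / 4)) sequentially"
    using assms by (rule Limsup_lessD)
  then obtain K where K: "\<And>k. K \<le> k \<Longrightarrow> 1 / ln (real k) * energy k < 1 / 4"
    by (auto simp: eventually_sequentially)
  \<comment> \<open>The additive constant \<open>energy K\<close> absorbs the finitely many
    \<open>m\<close> below \<open>K\<close>, where the hypothesis on the limsup says
    nothing.\<close>
  have growth: "energy m \<le> energy K + ln (real m) / 4" if "2 \<le> m" for m
  proof (cases "K \<le> m")
    case True
    have "0 < ln (real m)" using that by simp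
    with K[OF True] have "energy m \<le> ln (real m) / 4" by (simp add: field_simps)
    then show ?thesis by (simp add: add_increasing)
  next
    case False
    then show ?thesis using energy_mono[of m K] that by (simp add: add_increasing2)
  qed
  have "correlation k u \<le> 2 * energy K + ln (2 / \<bar>u\<bar>) / 2" if u: "0 < \<bar>u\<bar>" "\<bar>u\<bar> \<le> 1 / 2" for k u
  proof -
    let ?m = "nat \<lceil>1 / \<bar>u\<bar>\<rceil>"
    have inv: "2 \<le> 1 / \<bar>u\<bar>" using u by (simp add: field_simps)
    have m1: "1 / \<bar>u\<bar> \<le> real ?m" by (rule real_nat_ceiling_ge)
    \<comment> \<open>Rounding up adds less than 1, which is at most
      \<open>1 / \<bar>u\<bar>\<close>.\<close>
    have m2: "real ?m \<le> 2 / \<bar>u\<bar>" using inv by linarith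
    have "2 \<le> ?m" using m1 inv by linarith
    moreover have "ln (real ?m) \<le> ln (2 / \<bar>u\<bar>)" using m1 m2 inv by (subst ln_le_cancel_iff) auto
    ultimately show ?thesis
      using correlation_le_energy_inverse[OF u, of k] growth[of ?m] by linarith
  qed
  then show thesis by (rule that)
qed

text \<open>The threshold 1/4 is doubled by \<open>correlation_le_energy_inverse\<close>, so
  exponentiating the logarithmic bound yields \<open>\<bar>u\<bar>\<close> to the power -1/2. The
  resulting integrable majorant \<open>g\<close> serves all windows at once.\<close>

lemma second_moment_bound:
  assumes "limsup (\<lambda>k. ereal (1 / ln (real k) * energy k)) < ereal (1 / 4)"
  obtains D where "0 \<le> D"
    "\<And>k. (\<integral>\<^sup>+t. (\<integral>\<^sup>+s. ennreal (exp (correlation k (t - s))) \<partial>prior) \<partial>prior) \<le> ennreal D"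
proof -
  obtain C where C: "\<And>k u. 0 < \<bar>u\<bar> \<Longrightarrow> \<bar>u\<bar> \<le> 1 / 2 \<Longrightarrow> correlation k u \<le> C + ln (2 / \<bar>u\<bar>) / 2"
    using correlation_log_bound[OF assms] by blast
  define g where "g u = ennreal (exp C * 2 powr (1 / 2)) *
    (ennreal (\<bar>u\<bar> powr (- 1 / 2)) * indicator {- 1 / 2..1 / 2} u)" for u :: real
  have [measurable]: "g \<in> borel_measurable borel" unfolding g_def[abs_def] by measurable
  have [measurable]: "(\<lambda>x. correlation k (f x)) \<in> borel_measurable M"
    if [measurable]: "f \<in> borel_measurable M" for k f and M :: "'z measure"
    unfolding correlation_def by measurable
  have bound: "ennreal (exp (correlation k u)) \<le> g u" if "u \<noteq> 0" "\<bar>u\<bar> \<le> 1 / 2" for k u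
  proof -
    have "exp (correlation k u) \<le> exp (C + ln (2 / \<bar>u\<bar>) / 2)"
      using C[of u k] that by simp
    also have "\<dots> = exp C * 2 powr (1 / 2) * \<bar>u\<bar> powr (- 1 / 2)"
      using that by (simp add: powr_def ln_div mult_exp_exp diff_divide_distrib)
    finally have "ennreal (exp (correlation k u)) \<le> ennreal (exp C * 2 powr (1 / 2) * \<bar>u\<bar> powr (- 1 / 2))"
      by (rule ennreal_leI)
    moreover have "u \<in> {- 1 / 2..1 / 2}" using that by auto
    ultimately show ?thesis by (simp add: g_def ennreal_mult)
  qed
  have fin: "(\<integral>\<^sup>+u. g u \<partial>lborel) < \<infinity>"
    unfolding g_def using nn_integral_powr_minus_half
    by (subst nn_integral_cmult) (auto simp: ennreal_mult_less_top)
  then obtain D where D: "2 * (\<integral>\<^sup>+u. g u \<partial>lborel) = ennreal D" "0 \<le> D"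
    by (metis ennreal_cases ennreal_mult_less_top infinity_ennreal_def less_irrefl ennreal_numeral ennreal_less_top)
  have inner: "(\<integral>\<^sup>+s. ennreal (exp (correlation k (t - s))) \<partial>prior) \<le> ennreal D"
    if "t \<in> {0..1 / 2}" for k t
  proof -
    have "(\<integral>\<^sup>+s. ennreal (exp (correlation k (t - s))) * indicator {0..1 / 2} s \<partial>lborel)
        \<le> (\<integral>\<^sup>+s. g (t - s) \<partial>lborel)"
    proof (rule nn_integral_mono_AE, use AE_lborel_singleton[of t] in eventually_elim)
      case (elim s)
      have "\<bar>t - s\<bar> \<le> 1 / 2" if "s \<in> {0..1 / 2}"
        using that \<open>t \<in> _\<close> unfolding atLeastAtMost_iff by linarith
      with elim show ?case using bound[of "t - s" k] by (simp add: indicator_def)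
    qed
    also have "\<dots> = (\<integral>\<^sup>+u. g u \<partial>lborel)"
      using nn_integral_real_affine[of g "- 1" t] by simp
    finally show ?thesis
      by (subst nn_integral_prior) (auto simp: D(1)[symmetric] intro!: mult_left_mono)
  qed
  have "(\<integral>\<^sup>+t. (\<integral>\<^sup>+s. ennreal (exp (correlation k (t - s))) \<partial>prior) \<partial>prior) \<le> ennreal D" for k
  proof -
    interpret prior: prob_space prior by (rule prob_space_prior)
    have "AE t in prior. t \<in> {0..1 / 2}"
      unfolding prior_def by (rule AE_uniform_measureI) auto
    then have "AE t in prior. (\<integral>\<^sup>+s. ennreal (exp (correlation k (t - s))) \<partial>prior) \<le> ennreal D"
      by (rule eventually_mono) (rule inner)
    then have "(\<integral>\<^sup>+t. (\<integral>\<^sup>+s. ennreal (exp (correlation k (t - s))) \<partial>prior) \<partial>prior)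
      \<le> (\<integral>\<^sup>+t. ennreal D \<partial>prior)"
      by (rule nn_integral_mono_AE)
    then show ?thesis by (simp add: prior.emeasure_space_1)
  qed
  with D(2) show thesis by (rule that)
qed

text \<open>The law of the observation when the time is drawn from \<open>prior\<close>. For a fixed
  time this law can be singular to the noise; averaging over the time is what makes a comparison
  possible.\<close>

definition mixture :: "(int \<Rightarrow> complex) measure" where
  "mixture = distr (prior \<Otimes>\<^sub>M noise) borel (\<lambda>(t, \<omega>) n. trig_signal \<sigma> t n + \<omega> n)"

lemma sets_mixture [simp, measurable_cong]: "sets mixture = sets borel"
  by (simp add: mixture_def)

lemma measurable_add_signal [measurable]:
  "(\<lambda>(t, \<omega>) n. trig_signal \<sigma> t n + \<omega> n) \<in> measurable (prior \<Otimes>\<^sub>M noise) borel"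
  unfolding case_prod_beta' by (rule measurable_coordinatewise_then_product) measurable

lemma emeasure_mixture:
  assumes [measurable]: "A \<in> sets borel"
  shows "emeasure mixture A = (\<integral>\<^sup>+t. (\<integral>\<^sup>+\<omega>. indicator A (\<lambda>n. trig_signal \<sigma> t n + \<omega> n) \<partial>noise) \<partial>prior)"
proof -
  interpret noise: prob_space noise by (rule prob_space_noise)
  have m: "(\<lambda>p. indicator A ((\<lambda>(t, \<omega>) n. trig_signal \<sigma> t n + \<omega> n) p) :: ennreal) \<in> borel_measurable (prior \<Otimes>\<^sub>M noise)"
    by measurable
  have "emeasure mixture A = (\<integral>\<^sup>+p. indicator A ((\<lambda>(t, \<omega>) n. trig_signal \<sigma> t n + \<omega> n) p) \<partial>(prior \<Otimes>\<^sub>M noise))"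
    unfolding mixture_def
    using nn_integral_distr[OF measurable_add_signal, of "indicator A"] by simp
  also have "\<dots> = (\<integral>\<^sup>+t. (\<integral>\<^sup>+\<omega>. indicator A (\<lambda>n. trig_signal \<sigma> t n + \<omega> n) \<partial>noise) \<partial>prior)"
    using noise.nn_integral_fst[OF m] by simp
  finally show ?thesis .
qed

text \<open>A form of Cauchy-Schwarz: if \<open>h\<close> is the likelihood ratio then \<open>l h \<le> l\<^sup>2 + h\<^sup>2\<close>, and the second
  moment of \<open>h\<close> is the double integral bounded by \<open>D\<close>, uniformly in the window.\<close>

lemma mixture_cylinder_bound:
  assumes D: "\<And>k. (\<integral>\<^sup>+t. (\<integral>\<^sup>+s. ennreal (exp (correlation k (t - s))) \<partial>prior) \<partial>prior) \<le> ennreal D"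
    and A: "A \<in> sets borel" "cylinder k A"
  shows "ennreal l * emeasure mixture A \<le> ennreal l * ennreal l * emeasure noise A + ennreal D"
proof -
  interpret noise: prob_space noise by (rule prob_space_noise)
  interpret prior: prob_space prior by (rule prob_space_prior)
  interpret pair_sigma_finite prior noise ..
  have [measurable]: "A \<in> sets borel" "A \<in> sets noise" using A by auto
  define L where "L t \<omega> = ennreal (shift_density (window k) (trig_signal \<sigma> t) \<omega>)" for t \<omega>
  have [measurable]: "(\<lambda>x. L (f x) (g x)) \<in> borel_measurable M"
    if [measurable]: "f \<in> borel_measurable M" "g \<in> measurable M noise" for f g and M :: "'z measure"
  proof -
    have [measurable]: "(\<lambda>x. g x n) \<in> borel_measurable M" for n
      by (rule measurable_compose[OF that(2) measurable_noise_component])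
    show ?thesis unfolding L_def shift_density_def by measurable
  qed
  define h where "h \<omega> = (\<integral>\<^sup>+t. L t \<omega> \<partial>prior)" for \<omega>
  have [measurable]: "h \<in> borel_measurable noise" unfolding h_def[abs_def] by measurable
  have "emeasure mixture A = (\<integral>\<^sup>+t. (\<integral>\<^sup>+\<omega>. indicator A \<omega> * L t \<omega> \<partial>noise) \<partial>prior)"
    unfolding emeasure_mixture[OF A(1)] L_def by (simp add: nn_integral_shifted_cylinder[OF A])
  also have "\<dots> = (\<integral>\<^sup>+\<omega>. (\<integral>\<^sup>+t. indicator A \<omega> * L t \<omega> \<partial>prior) \<partial>noise)"
    by (rule Fubini'[symmetric]) measurable
  also have "\<dots> = (\<integral>\<^sup>+\<omega>. indicator A \<omega> * h \<omega> \<partial>noise)"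
    unfolding h_def by (intro nn_integral_cong nn_integral_cmult) measurable
  finally have "ennreal l * emeasure mixture A = (\<integral>\<^sup>+\<omega>. ennreal l * (indicator A \<omega> * h \<omega>) \<partial>noise)"
    by (simp add: nn_integral_cmult)
  also have "\<dots> \<le> (\<integral>\<^sup>+\<omega>. ennreal l * ennreal l * indicator A \<omega> + h \<omega> * h \<omega> \<partial>noise)"
  proof (rule nn_integral_mono)
    fix \<omega>
    \<comment> \<open>The square of the larger of the two numbers dominates their product.\<close>
    have "ennreal l * h \<omega> \<le> ennreal l * ennreal l + h \<omega> * h \<omega>"
    proof (cases "h \<omega> \<le> ennreal l")
      case True
      then show ?thesis by (intro add_increasing2 mult_left_mono) auto
    next
      case False
      then show ?thesis by (intro add_increasing mult_right_mono) auto
    qed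
    then show "ennreal l * (indicator A \<omega> * h \<omega>) \<le> ennreal l * ennreal l * indicator A \<omega> + h \<omega> * h \<omega>"
      by (auto simp: indicator_def)
  qed
  also have "\<dots> = ennreal l * ennreal l * emeasure noise A + (\<integral>\<^sup>+\<omega>. h \<omega> * h \<omega> \<partial>noise)"
    by (subst nn_integral_add) (auto simp: nn_integral_cmult)
  \<comment> \<open>The square is opened into two independent times \<open>t\<close> and
    \<open>s\<close>, and Fubini then moves the noise integral innermost.\<close>
  also have "(\<integral>\<^sup>+\<omega>. h \<omega> * h \<omega> \<partial>noise) = (\<integral>\<^sup>+\<omega>. (\<integral>\<^sup>+t. (\<integral>\<^sup>+s. L t \<omega> * L s \<omega> \<partial>prior) \<partial>prior) \<partial>noise)"
    unfolding h_def by (simp add: nn_integral_cmult nn_integral_multc)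
  also have "\<dots> = (\<integral>\<^sup>+t. (\<integral>\<^sup>+\<omega>. (\<integral>\<^sup>+s. L t \<omega> * L s \<omega> \<partial>prior) \<partial>noise) \<partial>prior)"
    by (rule Fubini') measurable
  also have "\<dots> = (\<integral>\<^sup>+t. (\<integral>\<^sup>+s. (\<integral>\<^sup>+\<omega>. L t \<omega> * L s \<omega> \<partial>noise) \<partial>prior) \<partial>prior)"
    by (intro nn_integral_cong Fubini') measurable
  also have "\<dots> = (\<integral>\<^sup>+t. (\<integral>\<^sup>+s. ennreal (exp (correlation k (t - s))) \<partial>prior) \<partial>prior)"
    by (simp add: L_def nn_integral_shift_density_mult inner_trig_signal correlation_def)
  also have "\<dots> \<le> ennreal D" by (rule D)
  finally show ?thesis by simp
qed

lemma mixture_open_bound: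
  assumes D: "\<And>k. (\<integral>\<^sup>+t. (\<integral>\<^sup>+s. ennreal (exp (correlation k (t - s))) \<partial>prior) \<partial>prior) \<le> ennreal D"
    and "open U"
  shows "ennreal l * emeasure mixture U \<le> ennreal l * ennreal l * emeasure noise U + ennreal D"
proof -
  obtain A where A: "incseq A" "\<And>m. open (A m)" "\<And>m. \<exists>k. cylinder k (A m)" "U = (\<Union>m. A m)"
    using open_eq_Union_cylinders[OF \<open>open U\<close>] by blast
  have "emeasure mixture U = (SUP m. emeasure mixture (A m))"
    unfolding A(4) using A(1,2) by (intro SUP_emeasure_incseq[symmetric]) auto
  then have "ennreal l * emeasure mixture U = (SUP m. ennreal l * emeasure mixture (A m))"
    by (simp add: SUP_mult_left_ennreal)
  also have "\<dots> \<le> ennreal l * ennreal l * emeasure noise U + ennreal D"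
  proof (rule SUP_least)
    fix m
    obtain k where "cylinder k (A m)" using A(3) by blast
    then have "ennreal l * emeasure mixture (A m) \<le> ennreal l * ennreal l * emeasure noise (A m) + ennreal D"
      using A(2) by (intro mixture_cylinder_bound[OF D]) auto
    also have "\<dots> \<le> ennreal l * ennreal l * emeasure noise U + ennreal D"
      using A(4) \<open>open U\<close> by (intro add_mono mult_left_mono emeasure_mono) auto
    finally show "ennreal l * emeasure mixture (A m) \<le> ennreal l * ennreal l * emeasure noise U + ennreal D" .
  qed
  finally show ?thesis .
qed

text \<open>The set \<open>N\<close> where the detector answers 1 would be null for the noise and of
  full measure for the mixture. Outer regularity encloses \<open>N\<close> in an open set of tiny
  noise measure, to which \<open>mixture_open_bound\<close> applies.\<close>

theorem no_detection:
  assumes "limsup (\<lambda>k. ereal (1 / ln (real k) * energy k)) < ereal (1 / 4)"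
  shows "\<not> admits_detection (trig_space \<sigma>)"
proof
  interpret noise: prob_space noise by (rule prob_space_noise)
  interpret prior: prob_space prior by (rule prob_space_prior)
  assume "admits_detection (trig_space \<sigma>)"
  then obtain T where T [measurable]: "T \<in> borel \<rightarrow>\<^sub>M count_space {0, 1 :: nat}"
    and T0: "AE \<xi> in noise. T \<xi> = 0"
    and T1: "\<And>t. AE \<xi> in noise. T (\<lambda>n. trig_signal \<sigma> t n + \<xi> n) = 1"
    unfolding admits_detection_def trig_space_def by blast
  define N where "N = {x. T x = 1}"
  have "N = T -` {1} \<inter> space borel" by (auto simp: N_def)
  then have N [measurable]: "N \<in> sets borel" using measurable_sets[OF T, of "{1}"] by simp
  then have [measurable]: "N \<in> sets noise" by simp
  have N0: "emeasure noise N = 0"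
  proof -
    have "AE \<xi> in noise. \<not> T \<xi> = 1" using T0 by eventually_elim simp
    from emeasure_eq_0_AE[OF this] show ?thesis by (simp add: N_def)
  qed
  have "(\<integral>\<^sup>+\<omega>. indicator N (\<lambda>n. trig_signal \<sigma> t n + \<omega> n) \<partial>noise) = (\<integral>\<^sup>+\<omega>. 1 \<partial>noise)" for t
    using T1[of t] by (intro nn_integral_cong_AE) (auto simp: N_def elim: eventually_mono)
  then have N1: "emeasure mixture N = 1"
    using noise.emeasure_space_1 prior.emeasure_space_1 by (simp add: emeasure_mixture[OF N])
  obtain D where D: "0 \<le> D"
    "\<And>k. (\<integral>\<^sup>+t. (\<integral>\<^sup>+s. ennreal (exp (correlation k (t - s))) \<partial>prior) \<partial>prior) \<le> ennreal D"
    using second_moment_bound[OF assms] by blast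
  \<comment> \<open>With noise measure of \<open>U\<close> below \<open>1 / (l * l)\<close> the
    bound reads \<open>l \<le> 1 + D\<close>, which this choice of \<open>l\<close>
    contradicts.\<close>
  define l where "l = D + 2"
  have "0 < l" using D(1) by (simp add: l_def)
  have "(INF U\<in>{U. N \<subseteq> U \<and> open U}. emeasure noise U) = 0"
    using outer_regular[of noise N] N0 by simp
  also have "\<dots> < ennreal (1 / (l * l))" using D by (simp add: l_def)
  finally obtain U where U: "N \<subseteq> U" "open U" "emeasure noise U < ennreal (1 / (l * l))"
    by (auto simp: INF_less_iff)
  have "ennreal l = ennreal l * emeasure mixture N" by (simp add: N1)
  also have "\<dots> \<le> ennreal l * emeasure mixture U"
    using U by (intro mult_left_mono emeasure_mono) auto
  also have "\<dots> \<le> ennreal l * ennreal l * emeasure noise U + ennreal D"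
    by (rule mixture_open_bound[OF D(2) U(2)])
  also have "\<dots> \<le> ennreal l * ennreal l * ennreal (1 / (l * l)) + ennreal D"
    using U(3) by (intro add_mono mult_left_mono) auto
  also have "\<dots> = ennreal (1 + D)"
  proof -
    have "ennreal l * ennreal l * ennreal (1 / (l * l)) = ennreal (l * l * (1 / (l * l)))"
      using \<open>0 < l\<close> by (subst ennreal_mult, simp, simp, subst ennreal_mult) simp_all
    also have "\<dots> = 1" using \<open>0 < l\<close> by simp
    finally show ?thesis using D(1) by simp
  qed
  finally show False using D by (simp add: l_def)
qed

end

subsection \<open>Recovery\<close>

lemma trig_signal_frac: "trig_signal \<sigma> (frac t) = trig_signal \<sigma> t"
proof
  fix n
  have "cis (2 * pi * of_int n * frac t) = cis (2 * pi * of_int n * t) / cis (2 * pi * of_int (n * \<lfloor>t\<rfloor>))"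
    by (simp add: cis_divide frac_def algebra_simps)
  then show "trig_signal \<sigma> (frac t) n = trig_signal \<sigma> t n"
    by (simp add: trig_signal_cis cis_multiple_2pi del: of_int_mult)
qed

lemma dist_cis: "cmod (cis a - cis b) = 2 * \<bar>sin ((a - b) / 2)\<bar>"
proof -
  have "(cmod (cis a - cis b))\<^sup>2 = 2 - 2 * cos (a - b)"
    using sin_cos_squared_add[of a] sin_cos_squared_add[of b]
    unfolding cmod_power2 by (simp add: cos_diff power2_diff algebra_simps)
  also have "\<dots> = (2 * \<bar>sin ((a - b) / 2)\<bar>)\<^sup>2"
  proof -
    have "cos (a - b) = cos (2 * ((a - b) / 2))" by (simp add: diff_divide_distrib)
    then show ?thesis unfolding cos_double_sin by (simp add: power_mult_distrib)
  qed
  finally show ?thesis by (rule power2_eq_imp_eq) auto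
qed

text \<open>\<open>2 * \<bar>sin (pi * (t - s))\<bar>\<close> is the chord between the points of the
  circle at \<open>t\<close> and \<open>s\<close>. The hypothesis is thus convergence modulo 1, and
  each component is an integer power of the circle point times a constant.\<close>

lemma tendsto_trig_signal:
  assumes "((\<lambda>i. sin (pi * (t i - s))) \<longlongrightarrow> 0) F"
  shows "((\<lambda>i. trig_signal \<sigma> (t i) n) \<longlongrightarrow> trig_signal \<sigma> s n) F"
proof -
  have eq: "cmod (cis (2 * pi * t i) - cis (2 * pi * s)) = 2 * \<bar>sin (pi * (t i - s))\<bar>" for i
    by (simp add: dist_cis right_diff_distrib[symmetric])
  have "((\<lambda>i. cmod (cis (2 * pi * t i) - cis (2 * pi * s))) \<longlongrightarrow> 0) F"
    unfolding eq using assms by (intro tendsto_mult_right_zero tendsto_rabs_zero)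
  then have "((\<lambda>i. cis (2 * pi * t i)) \<longlongrightarrow> cis (2 * pi * s)) F"
    by (simp add: tendsto_norm_zero_iff LIM_zero_iff)
  then have "((\<lambda>i. cis (2 * pi * t i) powi n * \<sigma> n) \<longlongrightarrow> cis (2 * pi * s) powi n * \<sigma> n) F"
    by (intro tendsto_mult tendsto_power_int tendsto_const) auto
  then show ?thesis by (simp add: trig_signal_cis cis_power_int mult_ac)
qed

section \<open>Estimating the time by scanning a grid\<close>

context decreasing_coefficients begin

text \<open>A matched filter: the log-likelihood of the time \<open>t\<close> on the window, up to
  the constant \<open>energy k / 2\<close>, which is the same for all times.\<close>

definition score :: "nat \<Rightarrow> real \<Rightarrow> (int \<Rightarrow> complex) \<Rightarrow> real" where
  "score k t y = (\<Sum>n\<in>window k. trig_signal \<sigma> t n \<bullet> y n)"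

text \<open>The spacing \<open>1 / (16 k)\<close> is fine enough for \<open>correlation_near\<close>, yet leaves only \<open>16 k\<close> points
  for the union bound.\<close>

definition grid :: "nat \<Rightarrow> nat \<Rightarrow> real" where
  "grid k j = real j / (16 * real k)"

text \<open>\<open>LEAST\<close> is junk when no grid point passes the threshold; this happens only on the bad event.\<close>

definition estimate :: "nat \<Rightarrow> (int \<Rightarrow> complex) \<Rightarrow> real" where
  "estimate k y = grid k (LEAST j. energy k / 2 \<le> score k (grid k j) y)"

text \<open>Both signs matter: the noise must neither hide the grid point near the true time nor
  promote a false one. Only grid points occur, so the event does not depend on the true
  time.\<close>

definition bad :: "nat \<Rightarrow> (int \<Rightarrow> complex) set" where
  "bad k = (\<Union>j<16 * k. {\<omega>. energy k / 4 \<le> \<bar>score k (grid k j) \<omega>\<bar>})"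

lemma score_signal_plus_noise:
  "score k t (\<lambda>n. trig_signal \<sigma> s n + \<omega> n) = correlation k (t - s) + score k t \<omega>"
  by (simp add: score_def correlation_def inner_add_right sum.distrib inner_trig_signal)

lemma score_measurable [measurable]: "score k t \<in> borel_measurable noise"
  unfolding score_def[abs_def] by measurable

lemma bad_sets [measurable]: "bad k \<in> sets noise"
proof -
  have "{\<omega> \<in> space noise. energy k / 4 \<le> \<bar>score k (grid k j) \<omega>\<bar>} \<in> sets noise" for j
    by measurable
  then show ?thesis unfolding bad_def by (intro sets.finite_UN) auto
qed

lemma estimate_measurable: "estimate k \<in> borel_measurable borel"
proof -
  have "estimate k \<in> borel_measurable noise"
    unfolding estimate_def[abs_def]
    by (rule measurable_compose[OF measurable_Least]) auto
  then show ?thesis by (simp add: measurable_cong_sets[OF sets_noise refl])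
qed

lemma measure_bad: "measure noise (bad k) \<le> 32 * real k * exp (- energy k / 32)"
proof -
  interpret prob_space noise by (rule prob_space_noise)
  let ?P = "\<lambda>j. {\<omega>. energy k / 4 \<le> score k (grid k j) \<omega>}"
  \<comment> \<open>The lower tail of the score is the upper tail for the negated signal.\<close>
  let ?M = "\<lambda>j. {\<omega>. energy k / 4 \<le> (\<Sum>n\<in>window k. (- trig_signal \<sigma> (grid k j) n) \<bullet> \<omega> n)}"
  have "{\<omega> \<in> space noise. energy k / 4 \<le> score k (grid k j) \<omega>} \<in> events"
    "{\<omega> \<in> space noise. energy k / 4 \<le> (\<Sum>n\<in>window k. (- trig_signal \<sigma> (grid k j) n) \<bullet> \<omega> n)} \<in> events" for j
    by measurable
  then have pm: "?P j \<in> events" "?M j \<in> events" for j by simp_all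
  have single: "measure noise (?P j \<union> ?M j) \<le> 2 * exp (- energy k / 32)" for j
  proof -
    have "measure noise (?P j) \<le> exp (- energy k / 32)" "measure noise (?M j) \<le> exp (- energy k / 32)"
      unfolding score_def by (intro inner_noise_tail; simp add: energy_def)+
    then show ?thesis using measure_Un_le[OF pm, of j j] by linarith
  qed
  have "bad k = (\<Union>j<16 * k. ?P j \<union> ?M j)"
    unfolding bad_def by (auto simp: score_def sum_negf abs_if)
  then have "measure noise (bad k) \<le> (\<Sum>j<16 * k. measure noise (?P j \<union> ?M j))"
    using pm by (auto intro!: measure_UNION_le)
  also have "\<dots> \<le> (\<Sum>j<16 * k. 2 * exp (- energy k / 32))"
    by (intro sum_mono single)
  finally show ?thesis by simp
qed

text \<open>Off the bad event the grid point just below \<open>s\<close> scores at least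
  \<open>3/4 - 1/4 = 1/2\<close> of the energy, so the threshold is met. The chosen point then has
  correlation above \<open>energy k / 4\<close>, and \<open>correlation_far\<close> turns this into
  closeness on the circle.\<close>

lemma estimate_accurate:
  assumes s: "0 \<le> s" "s < 1" and "0 < k" and \<omega>: "\<omega> \<notin> bad k"
    and E: "4 * (cmod (\<sigma> 0))\<^sup>2 < energy k"
  shows "\<bar>sin (pi * (estimate k (\<lambda>n. trig_signal \<sigma> s n + \<omega> n) - s))\<bar>
    \<le> 8 * (cmod (\<sigma> 0))\<^sup>2 / (energy k - 4 * (cmod (\<sigma> 0))\<^sup>2)"
proof -
  let ?y = "\<lambda>n. trig_signal \<sigma> s n + \<omega> n"
  let ?P = "\<lambda>j. energy k / 2 \<le> score k (grid k j) ?y"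
  have noise: "\<bar>score k (grid k j) \<omega>\<bar> < energy k / 4" if "j < 16 * k" for j
    using \<omega> that by (auto simp: bad_def not_le)
  define j0 where "j0 = nat \<lfloor>16 * real k * s\<rfloor>"
  have j0: "real j0 \<le> 16 * real k * s" "16 * real k * s < real j0 + 1"
    using s by (auto simp: j0_def)
  have "16 * real k * s < 16 * real k" using s \<open>0 < k\<close> by simp
  then have "j0 < 16 * k" using j0 by linarith
  have "16 * real k * \<bar>grid k j0 - s\<bar> = \<bar>16 * real k * (grid k j0 - s)\<bar>" by (simp add: abs_mult)
  also have "\<dots> = \<bar>real j0 - 16 * real k * s\<bar>"
    using \<open>0 < k\<close> by (simp add: grid_def right_diff_distrib)
  also have "\<dots> \<le> 1" using j0 by linarith
  finally have "3 / 4 * energy k \<le> correlation k (grid k j0 - s)" by (rule correlation_near)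
  then have P0: "?P j0"
    using noise[OF \<open>j0 < 16 * k\<close>] by (simp add: score_signal_plus_noise)
  define j where "j = (LEAST j. ?P j)"
  \<comment> \<open>\<open>LEAST\<close> ranges over all naturals; \<open>j \<le> j0\<close> puts
    the chosen index inside the range covered by \<open>bad\<close>.\<close>
  have "?P j" "j \<le> j0" unfolding j_def using P0 by (auto intro: LeastI Least_le)
  then have corr: "energy k / 4 < correlation k (grid k j - s)"
    using noise[of j] \<open>j0 < 16 * k\<close> by (simp add: score_signal_plus_noise)
  define q where "q = \<bar>sin (pi * (grid k j - s))\<bar>"
  have "q \<le> 8 * (cmod (\<sigma> 0))\<^sup>2 / (energy k - 4 * (cmod (\<sigma> 0))\<^sup>2)"
  proof (cases "q = 0")
    case False
    then have "0 < q" by (simp add: q_def)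
    have "energy k / 4 < (cmod (\<sigma> 0))\<^sup>2 + 2 * (cmod (\<sigma> 0))\<^sup>2 / q"
      using corr correlation_far[of "grid k j - s" k] False by (simp add: q_def)
    then show ?thesis using \<open>0 < q\<close> E by (simp add: field_simps)
  qed (use E in simp)
  then show ?thesis by (simp add: q_def j_def estimate_def)
qed

theorem recovery:
  assumes "limsup (\<lambda>k. ereal (1 / ln (real k) * energy k)) > ereal 96"
  shows "admits_recovery (trig_space \<sigma>)"
proof -
  interpret prob_space noise by (rule prob_space_noise)
  \<comment> \<open>A limsup gives the energy bound only for infinitely many \<open>k\<close>.
    Starting at \<open>i + 2\<close> keeps the logarithms positive and forces the selected windows
    to grow.\<close>
  have "\<exists>k\<ge>i + 2. 96 * ln (real k) < energy k" for i
  proof (rule ccontr)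
    assume *: "\<not> ?thesis"
    have "eventually (\<lambda>k. ereal (1 / ln (real k) * energy k) \<le> ereal 96) sequentially"
      unfolding eventually_sequentially
    proof (intro exI[of _ "i + 2"] allI impI)
      fix k assume k: "i + 2 \<le> k"
      then have "energy k \<le> 96 * ln (real k)" "0 < ln (real k)" using * by (auto simp: not_less)
      then show "ereal (1 / ln (real k) * energy k) \<le> ereal 96" by (simp add: field_simps)
    qed
    then have "limsup (\<lambda>k. ereal (1 / ln (real k) * energy k)) \<le> ereal 96"
      by (rule Limsup_bounded)
    with assms show False by simp
  qed
  then obtain r where r: "\<And>i. i + 2 \<le> r i" "\<And>i. 96 * ln (real (r i)) < energy (r i)"
    by metis
  have "filterlim (\<lambda>i. 96 * ln (real (i + 2))) at_top sequentially"
    by real_asymp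
  moreover have "96 * ln (real (i + 2)) \<le> energy (r i)" for i
  proof -
    have "ln (real (i + 2)) \<le> ln (real (r i))"
      using r(1)[of i] by (subst ln_le_cancel_iff) linarith+
    then show ?thesis using r(2)[of i] by linarith
  qed
  ultimately have lim: "filterlim (\<lambda>i. energy (r i)) at_top sequentially"
    by (rule filterlim_at_top_mono[OF _ always_eventually[OF allI]])
  have prob_bad: "prob (bad (r i)) \<le> 32 * inverse (real (Suc i) ^ 2)" for i
  proof -
    let ?k = "real (r i)"
    have k: "real (Suc i) \<le> ?k" "0 < ?k" using r(1)[of i] by linarith+
    have "prob (bad (r i)) \<le> 32 * ?k * exp (- energy (r i) / 32)" by (rule measure_bad)
    \<comment> \<open>Here \<open>96 / 32 = 3\<close>: the tail decays like the inverse cube of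
      \<open>r i\<close>, which after the union bound over order \<open>r i\<close> points remains
      summable.\<close>
    also have "\<dots> \<le> 32 * ?k * exp (- (3 * ln ?k))"
      using r(2)[of i] by (intro mult_left_mono) auto
    also have "exp (- (3 * ln ?k)) = inverse (?k ^ 3)"
      using k exp_of_nat_mult[of 3 "ln ?k"] by (simp add: exp_minus)
    also have "32 * ?k * inverse (?k ^ 3) = 32 * inverse (?k ^ 2)"
      using k by (simp add: field_simps power2_eq_square power3_eq_cube)
    also have "\<dots> \<le> 32 * inverse (real (Suc i) ^ 2)"
      using k by (intro mult_left_mono le_imp_inverse_le power_mono) auto
    finally show ?thesis .
  qed
  have "summable (\<lambda>i. prob (bad (r i)))"
  proof (rule summable_comparison_test')
    show "summable (\<lambda>i. 32 * inverse (real (Suc i) ^ 2))"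
      by (intro summable_mult) (subst summable_Suc_iff, simp add: inverse_power_summable)
  qed (use prob_bad in simp)
  then have good: "AE \<omega> in noise. eventually (\<lambda>i. \<omega> \<notin> bad (r i)) sequentially"
    using borel_cantelli_AE1[of "\<lambda>i. bad (r i)" noise] bad_sets
    by (simp add: less_top[symmetric])
  \<comment> \<open>The limit is taken in each coordinate of the signal rather than for the times,
    which may jump between the two ends of the unit interval. Where it does not exist,
    \<open>lim\<close> has a default value and measurability persists.\<close>
  define T where "T y n = lim (\<lambda>i. trig_signal \<sigma> (estimate (r i) y) n)" for y n
  have "T \<in> borel \<rightarrow>\<^sub>M borel"
    unfolding T_def[abs_def]
    by (intro measurable_coordinatewise_then_product borel_measurable_lim_metric
        measurable_trig_signal estimate_measurable)
  moreover have "AE \<omega> in noise. T (\<lambda>n. trig_signal \<sigma> t n + \<omega> n) = trig_signal \<sigma> t" for t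
    using good
  proof eventually_elim
    case (elim \<omega>)
    \<comment> \<open>The grid covers only \<open>[0, 1)\<close>, so the true time is reduced modulo
      1.\<close>
    let ?y = "\<lambda>n. trig_signal \<sigma> (frac t) n + \<omega> n"
    let ?c = "(cmod (\<sigma> 0))\<^sup>2"
    have "eventually (\<lambda>i. 4 * ?c < energy (r i)) sequentially"
      using lim by (simp add: filterlim_at_top_dense)
    with elim have bound: "eventually (\<lambda>i. norm (sin (pi * (estimate (r i) ?y - frac t)))
        \<le> 8 * ?c / (energy (r i) - 4 * ?c)) sequentially"
    proof eventually_elim
      case (elim i)
      then show ?case
        using estimate_accurate[of "frac t" "r i" \<omega>] r(1)[of i] by (simp add: frac_lt_1)
    qed
    have "((\<lambda>i. 8 * ?c / (energy (r i) - 4 * ?c)) \<longlongrightarrow> 0) sequentially"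
      by (intro tendsto_divide_0[OF tendsto_const] filterlim_at_top_imp_at_infinity
          filterlim_tendsto_add_at_top[OF tendsto_const[of "- (4 * ?c)"] lim, simplified])
    then have "(\<lambda>i. sin (pi * (estimate (r i) ?y - frac t))) \<longlonglongrightarrow> 0"
      by (rule Lim_null_comparison[OF bound])
    then have "(\<lambda>i. trig_signal \<sigma> (estimate (r i) ?y) n) \<longlonglongrightarrow> trig_signal \<sigma> (frac t) n" for n
      by (rule tendsto_trig_signal)
    then show ?case by (simp add: T_def trig_signal_frac limI fun_eq_iff)
  qed
  ultimately show ?thesis
    unfolding admits_recovery_def trig_space_def by blast
qed

end

theorem theorem1p3:
  shows "\<exists>a b :: real. 0 < a \<and> a < b \<and>
    (\<forall>\<sigma> :: int \<Rightarrow> complex.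
       (\<forall>n\<ge>0. cmod (\<sigma> (n + 1)) \<le> cmod (\<sigma> n)) \<longrightarrow>
       (\<forall>n\<le>0. cmod (\<sigma> (n - 1)) \<le> cmod (\<sigma> n)) \<longrightarrow>
       (let s = limsup (\<lambda>k::nat. ereal (1 / ln (real k) *
                  (\<Sum>n \<in> {n::int. \<bar>n\<bar> < int k}. (cmod (\<sigma> n))\<^sup>2)))
        in (s > ereal b \<longrightarrow> admits_recovery (trig_space \<sigma>)) \<and>
           (s < ereal a \<longrightarrow> \<not> admits_detection (trig_space \<sigma>))))"
proof -
  have "let s = limsup (\<lambda>k::nat. ereal (1 / ln (real k) *
                  (\<Sum>n \<in> {n::int. \<bar>n\<bar> < int k}. (cmod (\<sigma> n))\<^sup>2)))
        in (s > ereal 96 \<longrightarrow> admits_recovery (trig_space \<sigma>)) \<and>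
           (s < ereal (1 / 4) \<longrightarrow> \<not> admits_detection (trig_space \<sigma>))"
    if "\<forall>n\<ge>0. cmod (\<sigma> (n + 1)) \<le> cmod (\<sigma> n)" "\<forall>n\<le>0. cmod (\<sigma> (n - 1)) \<le> cmod (\<sigma> n)" for \<sigma>
  proof -
    interpret decreasing_coefficients \<sigma> by unfold_locales (use that in auto)
    show ?thesis
      using recovery no_detection unfolding Let_def energy_def window_def by blast
  qed
  then show ?thesis by (intro exI[of _ "1 / 4"] exI[of _ 96]) simp
qed

end
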